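(* Let $n\ge 1$ and let $X_1,\dots,X_n$ be independent random variables such that, for each $i$, $\mathbb P(X_i=\tfrac12)=T_i$, $\mathbb P(X_i=1)=W_i$, and $\mathbb P(X_i=0)=L_i:=1-T_i-W_i$, where $T_i,W_i,L_i\ge 0$. Let $X=\sum_{i=1}^n X_i$ and suppose that $\mathbb P(X\in\mathbb Z)>0$ and $\mathbb P(X\in\mathbb Z+\tfrac12)>0$. Put $\mu=\mathbb E[X]$, $\mu^{\mathrm{even}}=\mathbb E[X\mid X\in\mathbb Z]$, and $\mu^{\mathrm{odd}}=\mathbb E[X\mid X\in\mathbb Z+\tfrac12]$. Then: (1) The conditional distribution of $X$ given $X\in\mathbb Z$ is a Poisson binomial distribution, and the conditional distribution of $X$ given $X\in\mathbb Z+\tfrac12$ is a Poisson binomial distribution shifted to the right by $\tfrac12$ (i.e. the conditional distribution of $X-\tfrac12$ is Poisson binomial). Hence both conditional distributions are log-concave (on $\mathbb Z$ and on $\mathbb Z+\tfrac12$ respectively), and each has one or two modes. (2) If $m_{\mathrm{even}}$ is any mode of the distribution of $X$ given $X\in\mathbb Z$ and $m_{\mathrm{odd}}$ is any mode of the distribution of $X$ given $X\in\mathbb Z+\tfrac12$, then $|m_{\mathrm{even}}-\mu^{\mathrm{even}}|<1$ and $|m_{\mathrm{odd}}-\mu^{\mathrm{odd}}|<1$. (3) $|\mu^{\mathrm{even}}-\mu|\le\tfrac12$ and $|\mu^{\mathrm{odd}}-\mu|\le\tfrac12$, and hence $|\mu^{\mathrm{even}}-\mu^{\mathrm{odd}}|\le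 1$. (4) For any modes $m_{\mathrm{even}}$, $m_{\mathrm{odd}}$ as in (2), $|m_{\mathrm{even}}-\mu|<\tfrac32$ and $|m_{\mathrm{odd}}-\mu|<\tfrac32$, and hence $|m_{\mathrm{even}}-m_{\mathrm{odd}}|\le\tfrac52$.
   Context: A Poisson binomial distribution is the distribution of a sum $B_1+\dots+B_m$ of finitely many ($m\ge 0$) independent Bernoulli random variables with success probabilities $p_1,\dots,p_m\in[0,1]$ (not necessarily equal); for $m=0$ it is the point mass at $0$. A probability mass function $f$ on a lattice $\mathbb Z+c$ is log-concave if $f(x)^2\ge f(x-1)f(x+1)$ for all $x\in\mathbb Z+c$ and its support is a set of consecutive lattice points. A mode of a discrete distribution is a point at which its probability mass function attains its maximum. *)

theory Defs
  imports "HOL-Probability.Probability"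
begin

definition cond_distr :: "'a measure \<Rightarrow> 'a set \<Rightarrow> ('a \<Rightarrow> real) \<Rightarrow> real measure" where
  "cond_distr M A Y = distr (uniform_measure M A) borel Y"

definition cond_mean :: "'a measure \<Rightarrow> 'a set \<Rightarrow> ('a \<Rightarrow> real) \<Rightarrow> real" where
  "cond_mean M A Y = (\<integral>\<omega>. Y \<omega> \<partial>uniform_measure M A)"

definition int_lattice :: "real \<Rightarrow> real set" where
  "int_lattice c = range (\<lambda>k::int. of_int k + c)"

(* Under Pi_pmf the coordinates are independent, so this is the law of a sum of m independent
   Bernoulli variables. Note that bernoulli_pmf clips parameters outside [0,1]; the predicate
   below therefore restricts them explicitly. *)
definition poisson_binomial_pmf :: "nat \<Rightarrow> (nat \<Rightarrow> real) \<Rightarrow> real pmf" where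
  "poisson_binomial_pmf m p =
     map_pmf (\<lambda>b. \<Sum>i<m. of_bool (b i)) (Pi_pmf {..<m} False (\<lambda>i. bernoulli_pmf (p i)))"

(* The outer distr only moves the law from the discrete to the Borel sigma-algebra. *)
definition poisson_binomial :: "real measure \<Rightarrow> bool" where
  "poisson_binomial D \<longleftrightarrow>
     (\<exists>m p. (\<forall>i<m. p i \<in> {0..1}) \<and>
        D = distr (measure_pmf (poisson_binomial_pmf m p)) borel (\<lambda>x. x))"

(* The probability mass function of D is x \<mapsto> measure D {x}. *)
definition log_concave_distr :: "real \<Rightarrow> real measure \<Rightarrow> bool" where
  "log_concave_distr c D \<longleftrightarrow>
     measure D (int_lattice c) = 1 \<and>
     (\<forall>x\<in>int_lattice c. (measure D {x})\<^sup>2 \<ge> measure D {x - 1} * measure D {x + 1}) \<and>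
     (\<forall>x\<in>int_lattice c. \<forall>y\<in>int_lattice c. \<forall>z\<in>int_lattice c.
        x < y \<and> y < z \<and> measure D {x} > 0 \<and> measure D {z} > 0 \<longrightarrow> measure D {y} > 0)"

(* y ranges over all reals; for a discrete D the maximum is positive, so modes lie in the support. *)
definition is_mode :: "real measure \<Rightarrow> real \<Rightarrow> bool" where
  "is_mode D x \<longleftrightarrow> (\<forall>y. measure D {y} \<le> measure D {x})"

end

theory Submission
  imports Defs "HOL-Computational_Algebra.Fundamental_Theorem_Algebra"
begin

text \<open>Write \<open>G(z)\<close> for the product of the quadratics \<open>L\<^sub>i + T\<^sub>i z + W\<^sub>i z\<^sup>2\<close>: it is the
  probability generating function of \<open>2X\<close>.  Splitting \<open>G(z) = E(z\<^sup>2) + z O(z\<^sup>2)\<close> into even and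
  odd coefficients, the law of \<open>X\<close> given \<open>X \<in> \<int>\<close> has generating function \<open>E / E(1)\<close>, and that of
  \<open>X - 1/2\<close> given \<open>X \<in> \<int> + 1/2\<close> has generating function \<open>O / O(1)\<close>.

  Poisson binomial laws.  For \<open>Re z > 0\<close> every quadratic factor is at least as large in modulus
  at \<open>z\<close> as at \<open>-z\<close>, and one of them is strictly larger unless \<open>X\<close> has a deterministic parity.
  So \<open>|G(-z)| < |G(z)|\<close>, and neither \<open>E(z\<^sup>2) = (G(z) + G(-z)) / 2\<close> nor
  \<open>z O(z\<^sup>2) = (G(z) - G(-z)) / 2\<close> vanishes there.  Hence all roots of \<open>E\<close> and \<open>O\<close> are real and
  nonpositive (\<open>hermite_biehler_even_odd\<close>), and a polynomial of this kind with value 1 at 1 is a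
  product of factors \<open>1 - p + p z\<close> (\<open>nonpos_rooted_imp_bernoulli_poly\<close>).  Multiplication by such
  a factor preserves strict log-concavity on the support (\<open>slc_convolve_two_point\<close>), which gives
  log-concavity, and two modes must be neighbours (\<open>slc_maximizers_adjacent\<close>).

  Mode against mean (\<open>darroch\<close>).  Let \<open>G\<close> now have only negative roots, put \<open>H(z) = (1 - z) G(z)\<close>
  and let \<open>x\<^sub>j\<close> be the largest root of the \<open>j\<close>-th derivative of \<open>H\<close>, so \<open>x\<^sub>0 = 1\<close>.  The coefficient of
  \<open>z\<^sup>k\<close> in \<open>H\<close> is the increment of the coefficients of \<open>G\<close> at \<open>k\<close>; if it is nonnegative and
  \<open>k\<close> is at most the degree of \<open>G\<close>, then \<open>x\<^sub>k \<ge> 0\<close>.  The gaps \<open>x\<^sub>j - x\<^sub>j\<^sub>+\<^sub>1\<close> are nondecreasing in \<open>j\<close> as long as these roots are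
  nonnegative, which comes down to one application of the
  Cauchy-Schwarz inequality (\<open>largest_root_gap\<close>).  Therefore \<open>1 - x\<^sub>1 \<le> 1/k\<close>
  (\<open>peel_largest_roots\<close>), and reading \<open>H' \<ge> 0\<close> at \<open>1 - 1/k\<close> as an inequality for \<open>G'/G\<close> shows that
  the mean \<open>G'(1)/G(1)\<close> exceeds \<open>k - 1\<close>.  Exchanging successes and failures gives the other bound.

  Conditional means.  With \<open>\<rho> = G(-1)\<close> and \<open>D = G'(-1) + \<rho> G'(1)\<close> the two conditional means differ
  from the mean by \<open>-D / (2(1 + \<rho>))\<close> and \<open>D / (2(1 - \<rho>))\<close>, and \<open>|D| \<le> 1 - |\<rho>|\<close> follows by adding
  one factor at a time (\<open>parity_mean_discrepancy\<close>).

  The remaining bounds are triangle inequalities, sharpened from \<open>< 3\<close> to \<open>\<le> 5/2\<close> because the two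
  modes differ by an odd multiple of \<open>1/2\<close>.\<close>

section \<open>Polynomials as products of linear factors\<close>

text \<open>The roots are the negatives of the list entries, so nonpositive roots correspond to
  nonnegative entries.\<close>

definition root_poly :: "'a::field list \<Rightarrow> 'a poly" where
  "root_poly rs = (\<Prod>r\<leftarrow>rs. [:r, 1:])"

lemma root_poly_Nil [simp]: "root_poly [] = 1"
  and root_poly_Cons: "root_poly (r # rs) = [:r, 1:] * root_poly rs"
  by (simp_all add: root_poly_def)

lemma poly_root_poly_Cons [simp]:
  "poly (root_poly (r # rs)) z = (z + r) * poly (root_poly rs) z"
  by (simp add: root_poly_Cons algebra_simps)

lemma root_poly_nonzero [simp]: "root_poly rs \<noteq> 0"
  by (induction rs) (simp_all add: root_poly_Cons del: mult_pCons_left)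

lemma degree_root_poly [simp]: "degree (root_poly rs) = length rs"
  by (induction rs) (simp_all add: root_poly_Cons degree_mult_eq del: mult_pCons_left)

lemma poly_root_poly_eq_0_iff: "poly (root_poly rs) z = 0 \<longleftrightarrow> - z \<in> set rs"
  by (induction rs) (auto simp: add_eq_0_iff)

lemma poly_root_poly_pos:
  fixes z :: real
  assumes "\<And>r. r \<in> set rs \<Longrightarrow> z + r > 0"
  shows "poly (root_poly rs) z > 0"
  using assms by (induction rs) auto

lemma poly_pderiv_root_poly:
  assumes "\<And>r. r \<in> set rs \<Longrightarrow> z + r \<noteq> 0"
  shows "poly (pderiv (root_poly rs)) z = poly (root_poly rs) z * (\<Sum>r\<leftarrow>rs. 1 / (z + r))"
  using assms
proof (induction rs)
  case (Cons a rs)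
  have IH: "poly (pderiv (root_poly rs)) z = poly (root_poly rs) z * (\<Sum>r\<leftarrow>rs. 1 / (z + r))"
    using Cons by simp
  have "poly (pderiv (root_poly (a # rs))) z =
      (z + a) * poly (pderiv (root_poly rs)) z + poly (root_poly rs) z"
    by (simp add: root_poly_Cons pderiv_mult pderiv_pCons pderiv_add pderiv_smult algebra_simps)
  then show ?case using Cons.prems[of a] by (simp add: IH distrib_left)
qed simp

lemma poly_pderiv2_root_poly:
  assumes "\<And>r. r \<in> set rs \<Longrightarrow> z + r \<noteq> 0"
  shows "poly (pderiv (pderiv (root_poly rs))) z =
    poly (root_poly rs) z * ((\<Sum>r\<leftarrow>rs. 1 / (z + r))\<^sup>2 - (\<Sum>r\<leftarrow>rs. (1 / (z + r))\<^sup>2))"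
  using assms
proof (induction rs)
  case (Cons a rs)
  have a: "z + a \<noteq> 0" using Cons.prems by simp
  have IH: "poly (pderiv (pderiv (root_poly rs))) z =
    poly (root_poly rs) z * ((\<Sum>r\<leftarrow>rs. 1 / (z + r))\<^sup>2 - (\<Sum>r\<leftarrow>rs. (1 / (z + r))\<^sup>2))"
    using Cons by simp
  have D: "poly (pderiv (root_poly rs)) z = poly (root_poly rs) z * (\<Sum>r\<leftarrow>rs. 1 / (z + r))"
    using Cons.prems by (intro poly_pderiv_root_poly) simp
  have "poly (pderiv (pderiv (root_poly (a # rs)))) z =
    (z + a) * poly (pderiv (pderiv (root_poly rs))) z + 2 * poly (pderiv (root_poly rs)) z"
    by (simp add: root_poly_Cons pderiv_mult pderiv_pCons pderiv_add pderiv_smult algebra_simps)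
  also have "\<dots> = (z + a) * (poly (root_poly rs) z * ((\<Sum>r\<leftarrow>rs. 1 / (z + r))\<^sup>2 - (\<Sum>r\<leftarrow>rs. (1 / (z + r))\<^sup>2)))
     + 2 * (poly (root_poly rs) z * (\<Sum>r\<leftarrow>rs. 1 / (z + r)))"
    unfolding IH D ..
  also have "\<dots> = (z + a) * poly (root_poly rs) z *
     ((1 / (z + a) + (\<Sum>r\<leftarrow>rs. 1 / (z + r)))\<^sup>2 - ((1 / (z + a))\<^sup>2 + (\<Sum>r\<leftarrow>rs. (1 / (z + r))\<^sup>2)))"
  proof -
    have "(z + a) * (g * (s\<^sup>2 - t)) + 2 * (g * s) = (z + a) * g * ((u + s)\<^sup>2 - (u\<^sup>2 + t))"
      if "(z + a) * u = 1" for g s t u :: 'a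
      using that by algebra
    then show ?thesis using a by simp
  qed
  also have "(z + a) * poly (root_poly rs) z = poly (root_poly (a # rs)) z"
    by (simp add: algebra_simps)
  finally show ?case by simp
qed simp

lemma map_poly_of_real_mult:
  "map_poly complex_of_real (p * q) = map_poly complex_of_real p * map_poly complex_of_real q"
  by (rule poly_eqI) (simp add: coeff_map_poly coeff_mult)

lemma poly_map_poly_of_real:
  "poly (map_poly complex_of_real p) (complex_of_real x) = complex_of_real (poly p x)"
  by (induction p) (simp_all add: map_poly_pCons)

lemma map_poly_root_poly:
  "map_poly complex_of_real (root_poly rs) = root_poly (map complex_of_real rs)"
  by (induction rs)
    (simp_all add: root_poly_Cons map_poly_pCons map_poly_of_real_mult del: mult_pCons_left)

text \<open>The fundamental theorem of algebra supplies a complex root; being real, it can be divided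
  off without leaving the real polynomials.\<close>

lemma real_rooted_factorization:
  fixes p :: "real poly"
  assumes "p \<noteq> 0"
    and "\<And>z. poly (map_poly complex_of_real p) z = 0 \<Longrightarrow> z \<in> \<real>"
  shows "\<exists>c rs. c \<noteq> 0 \<and> p = smult c (root_poly rs)"
  using assms
proof (induction "degree p" arbitrary: p)
  case 0
  then obtain c where "p = [:c:]" by (metis degree_eq_zeroE)
  with 0 show ?case by (intro exI[of _ c] exI[of _ "[]"]) auto
next
  case (Suc d)
  have deg: "degree (map_poly complex_of_real p) = Suc d"
    using Suc.hyps by (simp add: degree_map_poly)
  then have "\<not> constant (poly (map_poly complex_of_real p))"
    by (simp add: constant_degree)
  then obtain z where z: "poly (map_poly complex_of_real p) z = 0"
    using fundamental_theorem_of_algebra by blast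
  then obtain x where x: "z = complex_of_real x" using Suc.prems(2) by (auto elim: Reals_cases)
  have "poly p x = 0" using z x by (simp add: poly_map_poly_of_real)
  then obtain q where q: "p = [:-x, 1:] * q" by (metis dvdE poly_eq_0_iff_dvd)
  have q0: "q \<noteq> 0" using Suc.prems q by auto
  have dq: "d = degree q" using Suc.hyps q q0 degree_mult_eq[of "[:-x,1:]" q] by simp
  have mp: "map_poly complex_of_real p = [:- complex_of_real x, 1:] * map_poly complex_of_real q"
    unfolding q map_poly_of_real_mult by (simp add: map_poly_pCons)
  have "\<exists>c rs. c \<noteq> 0 \<and> q = smult c (root_poly rs)"
    by (rule Suc.hyps(1)[OF dq q0]) (auto intro: Suc.prems(2) simp: mp)
  then obtain c rs where "c \<noteq> 0" "q = smult c (root_poly rs)" by blast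
  then show ?case using q
    by (intro exI[of _ c] exI[of _ "-x # rs"]) (simp add: root_poly_Cons del: mult_pCons_left)
qed

text \<open>Away from the real axis every term \<open>1 / (z + r)\<close> of the logarithmic derivative has an
  imaginary part of sign opposite to that of \<open>z\<close>, so the terms cannot cancel.\<close>

lemma pderiv_root_poly_real_rooted:
  fixes rs :: "real list"
  assumes "rs \<noteq> []" and "poly (pderiv (root_poly (map complex_of_real rs))) z = 0"
  shows "z \<in> \<real>"
proof (rule ccontr)
  assume "z \<notin> \<real>"
  then have Im: "Im z \<noteq> 0" by (simp add: complex_is_Real_iff)
  have nz: "z + complex_of_real r \<noteq> 0" for r
    using Im by (auto simp: complex_eq_iff)
  have summand: "Im z * Im (1 / (z + complex_of_real r)) < 0" for r
  proof -
    have "Im z * Im (1 / (z + complex_of_real r)) = - ((Im z)\<^sup>2 / (cmod (z + complex_of_real r))\<^sup>2)"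
      by (simp add: Im_divide cmod_def power2_eq_square)
    also have "\<dots> < 0" using Im nz[of r] by (simp add: divide_pos_pos)
    finally show ?thesis .
  qed
  have "Im z * Im (\<Sum>r\<leftarrow>rs. 1 / (z + complex_of_real r)) \<le> 0 \<and>
    (rs \<noteq> [] \<longrightarrow> Im z * Im (\<Sum>r\<leftarrow>rs. 1 / (z + complex_of_real r)) < 0)" for rs
  proof (induction rs)
    case (Cons a rs)
    then show ?case using summand[of a] by (auto simp: distrib_left)
  qed simp
  from this[of rs] have "(\<Sum>r\<leftarrow>rs. 1 / (z + complex_of_real r)) \<noteq> 0"
    using assms(1) by (metis less_irrefl mult_zero_right zero_complex.sel(2))
  moreover have "poly (root_poly (map complex_of_real rs)) z \<noteq> 0"
    unfolding poly_root_poly_eq_0_iff using nz by (metis add.right_inverse imageE set_map)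
  moreover have "poly (pderiv (root_poly (map complex_of_real rs))) z =
    poly (root_poly (map complex_of_real rs)) z * (\<Sum>r\<leftarrow>rs. 1 / (z + complex_of_real r))"
    using poly_pderiv_root_poly[of "map complex_of_real rs" z] nz by (auto simp: o_def)
  ultimately show False using assms(2) by simp
qed

section \<open>Strictly log-concave sequences\<close>

text \<open>Indexing by the integers, with value 0 off the support, spares the convolution argument any
  case distinction at the ends.\<close>

definition strictly_log_concave :: "(int \<Rightarrow> real) \<Rightarrow> bool" where
  "strictly_log_concave f \<longleftrightarrow>
     (\<forall>k. f k \<ge> 0) \<and>
     (\<forall>k. f k > 0 \<longrightarrow> f (k - 1) * f (k + 1) < (f k)\<^sup>2) \<and>
     (\<forall>i j k. i < j \<and> j < k \<and> f i > 0 \<and> f k > 0 \<longrightarrow> f j > 0)"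

lemma slc_nonneg: "strictly_log_concave f \<Longrightarrow> f k \<ge> 0"
  unfolding strictly_log_concave_def by blast

lemma slc_strict: "strictly_log_concave f \<Longrightarrow> f k > 0 \<Longrightarrow> f (k - 1) * f (k + 1) < (f k)\<^sup>2"
  unfolding strictly_log_concave_def by blast

lemma slc_between:
  assumes "strictly_log_concave f" "i \<le> j" "j \<le> k" "f i > 0" "f k > 0"
  shows "f j > 0"
proof (cases "i = j \<or> j = k")
  case False
  then have "i < j \<and> j < k \<and> f i > 0 \<and> f k > 0" using assms(2-5) by simp
  then show ?thesis using assms(1) unfolding strictly_log_concave_def by blast
qed (use assms(4,5) in auto)

lemma slc_log_concave:
  assumes "strictly_log_concave f"
  shows "f (k - 1) * f (k + 1) \<le> (f k)\<^sup>2"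
proof (cases "f k > 0")
  case True
  then show ?thesis using slc_strict[OF assms, of k] by simp
next
  case False
  then have "\<not> (f (k - 1) > 0 \<and> f (k + 1) > 0)"
    using slc_between[OF assms, of "k - 1" k "k + 1"] by auto
  then have "f (k - 1) = 0 \<or> f (k + 1) = 0"
    using slc_nonneg[OF assms, of "k - 1"] slc_nonneg[OF assms, of "k + 1"] by linarith
  then show ?thesis by auto
qed

text \<open>The product of the log-concavity inequalities at \<open>k - 1\<close> and at \<open>k\<close>, after cancellation; it
  controls the mixed term in a convolution.\<close>

lemma slc_spread:
  assumes "strictly_log_concave f"
  shows "f (k - 2) * f (k + 1) \<le> f (k - 1) * f k"
proof (cases "f (k - 2) > 0 \<and> f (k + 1) > 0")
  case True
  then have pos: "f (k - 1) > 0" "f k > 0"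
    using slc_between[OF assms, of "k - 2" _ "k + 1"] by auto
  have "f (k - 2) * f k \<le> (f (k - 1))\<^sup>2" "f (k - 1) * f (k + 1) \<le> (f k)\<^sup>2"
    using slc_log_concave[OF assms, of "k - 1"] slc_log_concave[OF assms, of k] by simp_all
  then have "(f (k - 2) * f k) * (f (k - 1) * f (k + 1)) \<le> (f (k - 1))\<^sup>2 * (f k)\<^sup>2"
    using pos True by (intro mult_mono) auto
  then have "(f (k - 1) * f k) * (f (k - 2) * f (k + 1)) \<le> (f (k - 1) * f k) * (f (k - 1) * f k)"
    by (simp add: power2_eq_square mult_ac)
  then show ?thesis using pos by (simp add: mult_le_cancel_left)
next
  case False
  then have "f (k - 2) = 0 \<or> f (k + 1) = 0"
    using slc_nonneg[OF assms, of "k - 2"] slc_nonneg[OF assms, of "k + 1"] by linarith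
  then show ?thesis
    using slc_nonneg[OF assms, of "k - 1"] slc_nonneg[OF assms, of k] by auto
qed

text \<open>The difference of the two sides of the log-concavity inequality is a combination, with
  weights \<open>a\<^sup>2\<close>, \<open>b\<^sup>2\<close> and \<open>a b\<close>, of the log-concavity differences at \<open>k\<close> and at \<open>k - 1\<close> and of the
  difference in \<open>slc_spread\<close>.  All are nonnegative, and one of the first two is positive wherever
  the new sequence is.\<close>

lemma slc_convolve_two_point:
  assumes f: "strictly_log_concave f" and ab: "a \<ge> 0" "b \<ge> 0"
  shows "strictly_log_concave (\<lambda>k. a * f k + b * f (k - 1))"
proof -
  let ?g = "\<lambda>k. a * f k + b * f (k - 1)"
  note nn = slc_nonneg[OF f]
  have pos_iff: "?g k > 0 \<longleftrightarrow> (a > 0 \<and> f k > 0) \<or> (b > 0 \<and> f (k - 1) > 0)" for k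
    using ab nn[of k] nn[of "k - 1"]
    by (smt (verit) mult_nonneg_nonneg mult_pos_pos mult_eq_0_iff)
  have strict: "?g (k - 1) * ?g (k + 1) < (?g k)\<^sup>2" if "?g k > 0" for k
  proof -
    have eq: "(?g k)\<^sup>2 - ?g (k - 1) * ?g (k + 1) =
       a\<^sup>2 * ((f k)\<^sup>2 - f (k - 1) * f (k + 1)) + b\<^sup>2 * ((f (k - 1))\<^sup>2 - f (k - 2) * f k)
       + a * b * (f (k - 1) * f k - f (k - 2) * f (k + 1))"
      by (simp add: power2_eq_square algebra_simps)
    have "0 \<le> a\<^sup>2 * ((f k)\<^sup>2 - f (k - 1) * f (k + 1))"
      using slc_log_concave[OF f, of k] by (intro mult_nonneg_nonneg) auto
    moreover have "0 \<le> b\<^sup>2 * ((f (k - 1))\<^sup>2 - f (k - 2) * f k)"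
      using slc_log_concave[OF f, of "k - 1"] by (intro mult_nonneg_nonneg) auto
    moreover have "0 \<le> a * b * (f (k - 1) * f k - f (k - 2) * f (k + 1))"
      using slc_spread[OF f, of k] ab by (intro mult_nonneg_nonneg) auto
    moreover have "0 < a\<^sup>2 * ((f k)\<^sup>2 - f (k - 1) * f (k + 1)) \<or>
        0 < b\<^sup>2 * ((f (k - 1))\<^sup>2 - f (k - 2) * f k)"
      using that[unfolded pos_iff] slc_strict[OF f, of k] slc_strict[OF f, of "k - 1"] by auto
    ultimately show ?thesis using eq by linarith
  qed
  have between: "?g j > 0" if "i < j" "j < k" and gi: "?g i > 0" and gk: "?g k > 0" for i j k
  proof -
    have "a > 0 \<or> b > 0" using gi[unfolded pos_iff] by blast
    then consider "a > 0" "b > 0" | "a > 0" "b = 0" | "a = 0" "b > 0"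
      using ab by fastforce
    then show ?thesis
    proof cases
      case 1
      obtain i' where i': "i' = i \<or> i' = i - 1" "f i' > 0" using gi[unfolded pos_iff] by blast
      obtain k' where k': "k' = k \<or> k' = k - 1" "f k' > 0" using gk[unfolded pos_iff] by blast
      have "f j > 0"
        by (rule slc_between[OF f, of i' j k']) (use i' k' \<open>i < j\<close> \<open>j < k\<close> in linarith)+
      then show ?thesis using 1 by (simp add: pos_iff)
    next
      case 2
      then have "f i > 0" "f k > 0" using gi gk unfolding pos_iff by auto
      then have "f j > 0" using slc_between[OF f, of i j k] \<open>i < j\<close> \<open>j < k\<close> by simp
      then show ?thesis using 2 by (simp add: pos_iff)
    next
      case 3
      then have "f (i - 1) > 0" "f (k - 1) > 0" using gi gk unfolding pos_iff by auto
      then have "f (j - 1) > 0"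
        using slc_between[OF f, of "i - 1" "j - 1" "k - 1"] \<open>i < j\<close> \<open>j < k\<close> by simp
      then show ?thesis using 3 by (simp add: pos_iff)
    qed
  qed
  show ?thesis unfolding strictly_log_concave_def
  proof (intro conjI allI impI)
    show "?g k \<ge> 0" for k using nn ab by simp
    fix k assume "?g k > 0"
    then show "?g (k - 1) * ?g (k + 1) < (?g k)\<^sup>2" by (rule strict)
  next
    show "?g j > 0" if "i < j \<and> j < k \<and> ?g i > 0 \<and> ?g k > 0" for i j k
      using that between by blast
  qed
qed

text \<open>The ratios \<open>f (l + 1) / f l\<close> strictly decrease along the support, so once they are at most
  \<open>1 / x\<close> they stay below it.  The value \<open>x = 1\<close> compares modes; a general \<open>x\<close> is needed for the
  coefficients of \<open>(x - z) G(z)\<close>.\<close>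

lemma slc_ratio_decreasing:
  assumes f: "strictly_log_concave f" and "x > 0" "f i > 0" "x * f (i + 1) \<le> f i"
    and "i + 1 < j" "f j > 0"
  shows "x * f j < f (j - 1)"
proof -
  have drop: "x * f (l + 1) < f l" if "f l > 0" "f (l - 1) > 0" "x * f l \<le> f (l - 1)" for l
  proof -
    have "f (l - 1) * (x * f (l + 1)) < x * (f l)\<^sup>2"
      using slc_strict[OF f, of l] that \<open>x > 0\<close> by (simp add: mult.left_commute)
    also have "\<dots> \<le> f (l - 1) * f l"
      using mult_right_mono[OF that(3), of "f l"] that by (simp add: power2_eq_square mult_ac)
    finally show ?thesis using that by simp
  qed
  show ?thesis using assms(5,6)
  proof (induction j rule: int_gr_induct)
    case base
    then have "f (i + 1) > 0" using slc_between[OF f, of i "i + 1" "i + 1 + 1"] assms(3) by simp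
    then show ?case using drop[of "i + 1"] assms(3,4) by (simp add: add.commute)
  next
    case (step j)
    have "f j > 0"
      by (rule slc_between[OF f, of i j "j + 1"]) (use step.hyps step.prems assms(3) in linarith)+
    moreover have "f (j - 1) > 0"
      by (rule slc_between[OF f, of i "j - 1" "j + 1"]) (use step.hyps step.prems assms(3) in linarith)+
    moreover note step.IH
    ultimately show ?case using drop[of j] by simp
  qed
qed

lemma slc_maximizers_adjacent:
  assumes f: "strictly_log_concave f" and "f i > 0" "i < j"
    and "\<And>l. f l \<le> f i" and "\<And>l. f l \<le> f j"
  shows "j = i + 1"
proof (rule ccontr)
  assume "j \<noteq> i + 1"
  with \<open>i < j\<close> have "i + 1 < j" by simp
  moreover have "f j > 0" using assms(2) assms(5)[of i] by simp
  ultimately have "f j < f (j - 1)"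
    using slc_ratio_decreasing[OF f, of 1 i j] assms(2) assms(4)[of "i + 1"] by simp
  then show False using assms(5)[of "j - 1"] by simp
qed

section \<open>Coefficient sequences of products of linear polynomials\<close>

definition icoeff :: "real poly \<Rightarrow> int \<Rightarrow> real" where
  "icoeff p k = (if k < 0 then 0 else coeff p (nat k))"

lemma icoeff_of_nat [simp]: "icoeff p (int n) = coeff p n"
  by (simp add: icoeff_def)

lemma icoeff_mult_linear:
  "icoeff ([:a, b:] * p) k = a * icoeff p k + b * icoeff p (k - 1)"
proof -
  consider "k < 0" | "k = 0" | "k > 0" by linarith
  then show ?thesis
  proof cases
    case 3
    define n where "n = nat (k - 1)"
    have k: "k = int (Suc n)" using 3 by (simp add: n_def)
    then have "k - 1 = int n" by simp
    then show ?thesis unfolding k by (simp only: icoeff_of_nat) simp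
  qed (simp_all add: icoeff_def)
qed

lemma slc_icoeff_1: "strictly_log_concave (icoeff 1)"
  by (auto simp: strictly_log_concave_def icoeff_def)

lemma slc_prod_linear:
  assumes "\<And>x. x \<in> set xs \<Longrightarrow> a x \<ge> 0 \<and> b x \<ge> 0"
  shows "strictly_log_concave (icoeff (\<Prod>x\<leftarrow>xs. [:a x, b x:]))"
  using assms
proof (induction xs)
  case (Cons x xs)
  have "icoeff (\<Prod>x\<leftarrow>x # xs. [:a x, b x:]) =
     (\<lambda>k. a x * icoeff (\<Prod>x\<leftarrow>xs. [:a x, b x:]) k + b x * icoeff (\<Prod>x\<leftarrow>xs. [:a x, b x:]) (k - 1))"
    by (rule ext) (simp add: icoeff_mult_linear del: mult_pCons_left)
  then show ?case using slc_convolve_two_point Cons by simp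
qed (simp add: slc_icoeff_1)

section \<open>Largest roots of successive derivatives\<close>

text \<open>Let \<open>H(z) = (x\<^sub>0 - z) G(z)\<close> with \<open>G\<close> having only negative roots; \<open>crit\<close> says that \<open>x\<^sub>1\<close> is a
  critical point of \<open>H\<close>.  \<open>H''\<close> is negative between \<open>2 x\<^sub>1 - x\<^sub>0\<close> and \<open>x\<^sub>1\<close>, so its
  largest root \<open>x\<^sub>2\<close>, when nonnegative, satisfies \<open>x\<^sub>0 - x\<^sub>1 \<le> x\<^sub>1 - x\<^sub>2\<close>: the gaps between the largest roots of
  successive derivatives never shrink.

  With \<open>w\<^sub>r = 1 / (z + r)\<close>, with \<open>\<psi>\<close> and \<open>\<sigma>\<close> the sums of the \<open>w\<^sub>r\<close> and of their squares, and with
  \<open>\<delta> = x\<^sub>0 - x\<^sub>1\<close> and \<open>e = x\<^sub>1 - z\<close>, one has \<open>H''/G = (\<delta> + e) (\<psi>\<^sup>2 - \<sigma>) - 2 \<psi>\<close>, while \<open>crit\<close> reads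
  \<open>\<delta> \<Sum> w\<^sub>r / (1 + e w\<^sub>r) = 1\<close>.  Cauchy-Schwarz bounds \<open>\<psi>\<^sup>2\<close> by
  \<open>(\<Sum> w\<^sub>r / (1 + e w\<^sub>r)) (\<Sum> w\<^sub>r (1 + e w\<^sub>r))\<close>, that is \<open>\<delta> \<psi>\<^sup>2 \<le> \<psi> + e \<sigma>\<close>, and this suffices for
  \<open>e < \<delta>\<close>.\<close>

lemma largest_root_gap:
  fixes rs :: "real list"
  assumes rs: "rs \<noteq> []" "\<And>r. r \<in> set rs \<Longrightarrow> 0 < r"
    and z: "0 \<le> z" "z \<le> x\<^sub>1" "x\<^sub>1 - z < x\<^sub>0 - x\<^sub>1"
    and crit: "(x\<^sub>0 - x\<^sub>1) * (\<Sum>r\<leftarrow>rs. 1 / (x\<^sub>1 + r)) = 1"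
  shows "poly (pderiv (pderiv ([:x\<^sub>0, -1:] * root_poly rs))) z < 0"
proof -
  define \<delta> e where "\<delta> = x\<^sub>0 - x\<^sub>1" and "e = x\<^sub>1 - z"
  define w where "w r = 1 / (z + r)" for r
  define \<psi> \<sigma> where "\<psi> = (\<Sum>r\<leftarrow>rs. w r)" and "\<sigma> = (\<Sum>r\<leftarrow>rs. (w r)\<^sup>2)"
  have e: "0 \<le> e" "e < \<delta>" using z by (auto simp: e_def \<delta>_def)
  have wpos: "w r > 0" if "r \<in> set rs" for r
    using rs(2)[OF that] z by (simp add: w_def)
  have \<psi>: "\<psi> > 0"
    using sum_list_strict_mono[OF rs(1), of "\<lambda>_. 0" w] wpos by (simp add: \<psi>_def)
  have \<sigma>: "\<sigma> \<ge> 0" unfolding \<sigma>_def by (intro sum_list_nonneg) auto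
  have shift: "1 / (x\<^sub>1 + r) = w r / (1 + e * w r)" if "r \<in> set rs" for r
    using rs(2)[OF that] z by (simp add: w_def e_def field_simps)
  have crit': "\<delta> * (\<Sum>r\<leftarrow>rs. w r / (1 + e * w r)) = 1"
    using crit shift by (simp add: \<delta>_def cong: map_cong)
  have key: "\<delta> * \<psi>\<^sup>2 \<le> \<psi> + e * \<sigma>"
  proof -
    \<comment> \<open>Cauchy-Schwarz in tangent form, at the value of \<open>t\<close> for which the bound is sharpest.\<close>
    define t where "t = \<delta> * \<psi>"
    have "2 * t * w r - t\<^sup>2 * (w r / (1 + e * w r)) \<le> w r + e * (w r)\<^sup>2" if "r \<in> set rs" for r
    proof -
      have d: "1 + e * w r > 0" using wpos[OF that] e by (simp add: add_pos_nonneg)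
      have "0 \<le> ((1 + e * w r) - t)\<^sup>2 * (w r / (1 + e * w r))"
        using wpos[OF that] d by simp
      also have "\<dots> = w r + e * (w r)\<^sup>2 - (2 * t * w r - t\<^sup>2 * (w r / (1 + e * w r)))"
        using d by (simp add: field_simps power2_eq_square)
      finally show ?thesis by simp
    qed
    then have "(\<Sum>r\<leftarrow>rs. 2 * t * w r - t\<^sup>2 * (w r / (1 + e * w r))) \<le> (\<Sum>r\<leftarrow>rs. w r + e * (w r)\<^sup>2)"
      by (rule sum_list_mono)
    then have "2 * t * \<psi> - t\<^sup>2 * (\<Sum>r\<leftarrow>rs. w r / (1 + e * w r)) \<le> \<psi> + e * \<sigma>"
      by (simp only: sum_list_addf sum_list_subtractf sum_list_const_mult \<psi>_def \<sigma>_def)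
    moreover have "t\<^sup>2 * (\<Sum>r\<leftarrow>rs. w r / (1 + e * w r)) = \<delta> * \<psi>\<^sup>2"
    proof -
      have "t\<^sup>2 * (\<Sum>r\<leftarrow>rs. w r / (1 + e * w r)) =
        \<delta> * \<psi>\<^sup>2 * (\<delta> * (\<Sum>r\<leftarrow>rs. w r / (1 + e * w r)))"
        by (simp add: t_def power2_eq_square)
      then show ?thesis using crit' by simp
    qed
    moreover have "2 * t * \<psi> = 2 * (\<delta> * \<psi>\<^sup>2)" by (simp add: t_def power2_eq_square)
    ultimately show ?thesis by linarith
  qed
  have "\<delta> * ((\<delta> + e) * (\<psi>\<^sup>2 - \<sigma>)) = (\<delta> + e) * (\<delta> * \<psi>\<^sup>2) - \<delta> * (\<delta> + e) * \<sigma>"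
    by (simp add: algebra_simps)
  also have "\<dots> \<le> (\<delta> + e) * (\<psi> + e * \<sigma>) - \<delta> * (\<delta> + e) * \<sigma>"
    using key e by (intro diff_right_mono mult_left_mono) auto
  also have "\<dots> = (\<delta> + e) * \<psi> - (\<delta> + e) * (\<delta> - e) * \<sigma>"
    by (simp add: algebra_simps)
  also have "\<dots> \<le> (\<delta> + e) * \<psi>" using e \<sigma> by simp
  also have "\<dots> < (\<delta> + \<delta>) * \<psi>" using e \<psi> by simp
  finally have "\<delta> * ((\<delta> + e) * (\<psi>\<^sup>2 - \<sigma>)) < \<delta> * (2 * \<psi>)" by (simp add: algebra_simps)
  then have neg: "(\<delta> + e) * (\<psi>\<^sup>2 - \<sigma>) - 2 * \<psi> < 0" using e by simp
  have nz: "z + r \<noteq> 0" if "r \<in> set rs" for r using rs(2)[OF that] z by simp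
  have "poly (pderiv (pderiv ([:x\<^sub>0, -1:] * root_poly rs))) z =
     (x\<^sub>0 - z) * poly (pderiv (pderiv (root_poly rs))) z - 2 * poly (pderiv (root_poly rs)) z"
    by (simp add: pderiv_mult pderiv_pCons pderiv_add pderiv_smult pderiv_minus pderiv_diff algebra_simps)
  also have "\<dots> = poly (root_poly rs) z * ((\<delta> + e) * (\<psi>\<^sup>2 - \<sigma>) - 2 * \<psi>)"
    using nz by (simp add: poly_pderiv2_root_poly poly_pderiv_root_poly \<psi>_def \<sigma>_def w_def \<delta>_def e_def
        algebra_simps)
  also have "\<dots> < 0"
    using neg rs z by (intro mult_pos_neg poly_root_poly_pos) (auto intro: add_nonneg_pos)
  finally show ?thesis .
qed

lemma poly_pderiv_positive_root_times:
  fixes rs :: "real list"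
  assumes "\<And>r. r \<in> set rs \<Longrightarrow> 0 < r" "0 \<le> z"
  shows "poly (pderiv ([:x\<^sub>0, -1:] * root_poly rs)) z =
     poly (root_poly rs) z * ((x\<^sub>0 - z) * (\<Sum>r\<leftarrow>rs. 1 / (z + r)) - 1)"
proof -
  have nz: "z + r \<noteq> 0" if "r \<in> set rs" for r using assms(1)[OF that] assms(2) by simp
  have "poly (pderiv ([:x\<^sub>0, -1:] * root_poly rs)) z =
     (x\<^sub>0 - z) * poly (pderiv (root_poly rs)) z - poly (root_poly rs) z"
    by (simp add: pderiv_mult pderiv_pCons pderiv_add pderiv_smult pderiv_minus algebra_simps)
  then show ?thesis using nz by (simp add: poly_pderiv_root_poly algebra_simps)
qed

text \<open>On the nonnegative axis \<open>H'\<close> is \<open>G\<close> times \<open>(x\<^sub>0 - z) \<psi>(z) - 1\<close>, where \<open>\<psi>\<close> is positive and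
  decreasing.  The product \<open>(x\<^sub>0 - z) \<psi>(z)\<close> decreases up to \<open>x\<^sub>0\<close> and is nonpositive from there on, so
  it passes the value 1 only once.\<close>

lemma pderiv_sign_around_critical_point:
  fixes rs :: "real list"
  assumes rs: "\<And>r. r \<in> set rs \<Longrightarrow> 0 < r" and x: "0 \<le> x\<^sub>1" "x\<^sub>1 < x\<^sub>0"
    and crit: "poly (pderiv ([:x\<^sub>0, -1:] * root_poly rs)) x\<^sub>1 = 0"
  shows "(x\<^sub>0 - x\<^sub>1) * (\<Sum>r\<leftarrow>rs. 1 / (x\<^sub>1 + r)) = 1"
    and "0 \<le> z \<Longrightarrow> z \<le> x\<^sub>1 \<Longrightarrow> 0 \<le> poly (pderiv ([:x\<^sub>0, -1:] * root_poly rs)) z"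
    and "x\<^sub>1 < z \<Longrightarrow> poly (pderiv ([:x\<^sub>0, -1:] * root_poly rs)) z < 0"
proof -
  let ?\<psi> = "\<lambda>z. \<Sum>r\<leftarrow>rs. 1 / (z + r)"
  have Gpos: "poly (root_poly rs) z > 0" if "0 \<le> z" for z
    using rs that by (intro poly_root_poly_pos) (auto intro: add_nonneg_pos)
  have \<psi>nn: "?\<psi> z \<ge> 0" if "0 \<le> z" for z
    using rs that by (intro sum_list_nonneg) (auto simp: less_imp_le)
  have anti: "?\<psi> z' \<le> ?\<psi> z" if "0 \<le> z" "z \<le> z'" for z z'
    using rs that by (intro sum_list_mono divide_left_mono) (auto intro!: mult_pos_pos add_nonneg_pos)
  show crit': "(x\<^sub>0 - x\<^sub>1) * ?\<psi> x\<^sub>1 = 1"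
    using crit Gpos[OF x(1)] poly_pderiv_positive_root_times[OF rs x(1), where x\<^sub>0 = x\<^sub>0] by simp
  have \<psi>pos: "?\<psi> x\<^sub>1 > 0" using crit' \<psi>nn[OF x(1)] by (cases "?\<psi> x\<^sub>1 = 0") auto
  show "0 \<le> poly (pderiv ([:x\<^sub>0, -1:] * root_poly rs)) z" if "0 \<le> z" "z \<le> x\<^sub>1"
  proof -
    have "(x\<^sub>0 - x\<^sub>1) * ?\<psi> x\<^sub>1 \<le> (x\<^sub>0 - z) * ?\<psi> z"
      using that x \<psi>pos anti[of z x\<^sub>1] by (intro mult_mono) auto
    then show ?thesis
      using crit' Gpos[OF that(1)] poly_pderiv_positive_root_times[OF rs that(1), where x\<^sub>0 = x\<^sub>0] by simp
  qed
  show "poly (pderiv ([:x\<^sub>0, -1:] * root_poly rs)) z < 0" if "x\<^sub>1 < z"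
  proof -
    have z: "0 \<le> z" using that x by simp
    have "(x\<^sub>0 - z) * ?\<psi> z < 1"
    proof (cases "z < x\<^sub>0")
      case True
      have "(x\<^sub>0 - z) * ?\<psi> z \<le> (x\<^sub>0 - z) * ?\<psi> x\<^sub>1"
        using True that x anti[of x\<^sub>1 z] by (intro mult_left_mono) auto
      also have "\<dots> < (x\<^sub>0 - x\<^sub>1) * ?\<psi> x\<^sub>1" using that \<psi>pos by simp
      finally show ?thesis using crit' by simp
    next
      case False
      then show ?thesis using \<psi>nn[OF z] mult_nonpos_nonneg[of "x\<^sub>0 - z" "?\<psi> z"] by simp
    qed
    then show ?thesis
      using Gpos[OF z] poly_pderiv_positive_root_times[OF rs z, where x\<^sub>0 = x\<^sub>0]
      by (simp add: mult_pos_neg)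
  qed
qed

lemma root_poly_remove1:
  "a \<in> set rs \<Longrightarrow> root_poly rs = [:a, 1:] * root_poly (remove1 a rs)"
  by (induction rs) (auto simp: root_poly_Cons mult.left_commute simp del: mult_pCons_left)

lemma slc_root_poly: "(\<And>r. r \<in> set rs \<Longrightarrow> 0 \<le> r) \<Longrightarrow> strictly_log_concave (icoeff (root_poly rs))"
  unfolding root_poly_def using slc_prod_linear[of rs "\<lambda>r. r" "\<lambda>_. 1"] by simp

lemma coeff_root_poly_pos:
  fixes rs :: "real list"
  assumes "\<And>r. r \<in> set rs \<Longrightarrow> 0 < r" "k \<le> length rs"
  shows "0 < coeff (root_poly rs) k"
proof -
  have "icoeff (root_poly rs) 0 > 0"
    using poly_root_poly_pos[of rs 0] assms(1) by (simp add: icoeff_def poly_0_coeff_0)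
  moreover have "lead_coeff (root_poly rs) = 1"
    by (induction rs) (simp_all add: root_poly_Cons lead_coeff_mult del: mult_pCons_left)
  then have "icoeff (root_poly rs) (int (length rs)) > 0" by simp
  ultimately have "icoeff (root_poly rs) (int k) > 0"
    using slc_between[OF slc_root_poly[of rs], of 0 "int k" "int (length rs)"] assms
    by (simp add: less_imp_le)
  then show ?thesis by simp
qed

lemma map_poly_of_real_pderiv:
  "map_poly complex_of_real (pderiv p) = pderiv (map_poly complex_of_real p)"
  by (rule poly_eqI) (simp add: coeff_map_poly coeff_pderiv)

text \<open>The derivative of \<open>H\<close> has again the form of \<open>H\<close>, which makes the gap estimate iterable.  It
  is real-rooted; 0 is not a root, a further positive root is excluded by the sign of \<open>H'\<close>, and \<open>x\<^sub>1\<close> is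
  a simple root because \<open>H''(x\<^sub>1) < 0\<close>.\<close>

lemma pderiv_split_positive_root:
  fixes rs :: "real list"
  assumes rs: "\<And>r. r \<in> set rs \<Longrightarrow> 0 < r"
    and x: "0 < x\<^sub>1" "x\<^sub>1 < x\<^sub>0"
    and crit: "poly (pderiv ([:x\<^sub>0, -1:] * root_poly rs)) x\<^sub>1 = 0"
    and pos0: "0 < poly (pderiv ([:x\<^sub>0, -1:] * root_poly rs)) 0"
  obtains c ss where "c > 0" "\<And>s. s \<in> set ss \<Longrightarrow> 0 < s" "Suc (length ss) = length rs"
    "pderiv ([:x\<^sub>0, -1:] * root_poly rs) = smult c ([:x\<^sub>1, -1:] * root_poly ss)"
proof -
  let ?H = "[:x\<^sub>0, -1:] * root_poly rs"
  have rs_ne: "rs \<noteq> []" using pos0 by (auto simp: pderiv_pCons)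
  have H: "?H = - root_poly (- x\<^sub>0 # rs)" by (simp add: root_poly_Cons)
  have "map_poly complex_of_real ?H = - root_poly (map complex_of_real (- x\<^sub>0 # rs))"
    unfolding H map_poly_root_poly[symmetric] by (rule poly_eqI) (simp add: coeff_map_poly)
  then have "z \<in> \<real>" if "poly (map_poly complex_of_real (pderiv ?H)) z = 0" for z
    using that pderiv_root_poly_real_rooted[of "- x\<^sub>0 # rs" z]
    by (simp add: map_poly_of_real_pderiv pderiv_minus del: mult_pCons_left list.map)
  moreover have H'0: "pderiv ?H \<noteq> 0" using pos0 by (auto simp del: mult_pCons_left)
  ultimately obtain c ts where c: "c \<noteq> 0" and ts: "pderiv ?H = smult c (root_poly ts)"
    using real_rooted_factorization by blast
  have root_iff: "poly (pderiv ?H) y = 0 \<longleftrightarrow> - y \<in> set ts" for y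
    unfolding ts using c by (simp add: poly_root_poly_eq_0_iff)
  have in_ts: "- x\<^sub>1 \<in> set ts" using crit root_iff by blast
  define ss where "ss = remove1 (- x\<^sub>1) ts"
  have split: "pderiv ?H = smult (- c) ([:x\<^sub>1, -1:] * root_poly ss)"
  proof -
    have "[:x\<^sub>1, -1:] = - [:- x\<^sub>1, 1:]" by simp
    then show ?thesis unfolding ts ss_def root_poly_remove1[OF in_ts]
      by (simp del: mult_pCons_left minus_pCons)
  qed
  have beyond: "poly (pderiv ?H) z < 0" if "0 < y" "y < x\<^sub>0" "poly (pderiv ?H) y = 0" "y < z" for y z
    using pderiv_sign_around_critical_point(3)[of rs y x\<^sub>0 z] rs that by simp
  have "(x\<^sub>0 - x\<^sub>1) * (\<Sum>r\<leftarrow>rs. 1 / (x\<^sub>1 + r)) = 1"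
    using pderiv_sign_around_critical_point(1)[of rs x\<^sub>1 x\<^sub>0] rs x crit by simp
  then have simple_root: "poly (pderiv (pderiv ?H)) x\<^sub>1 < 0"
    using largest_root_gap[of rs x\<^sub>1 x\<^sub>1 x\<^sub>0] rs_ne rs x by simp
  have pos: "0 < s" if s: "s \<in> set ss" for s
  proof (rule ccontr)
    assume "\<not> 0 < s"
    have root: "poly (pderiv ?H) (- s) = 0"
      using s set_remove1_subset[of "- x\<^sub>1" ts] unfolding root_iff ss_def by auto
    with pos0 have "s \<noteq> 0" by (auto simp del: mult_pCons_left)
    with \<open>\<not> 0 < s\<close> have s0: "0 < - s" by simp
    have "\<not> x\<^sub>1 < - s" using beyond[OF x crit, of "- s"] root by linarith
    moreover from this have "\<not> - s < x\<^sub>1" using beyond[OF s0 _ root, of x\<^sub>1] crit x by linarith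
    ultimately have "- x\<^sub>1 \<in> set ss" using s by simp
    then have "poly (root_poly ss) x\<^sub>1 = 0" by (simp add: poly_root_poly_eq_0_iff)
    then have "poly (pderiv (pderiv ?H)) x\<^sub>1 = 0"
      unfolding split by (simp add: pderiv_smult pderiv_minus pderiv_mult del: mult_pCons_left)
    with simple_root show False by simp
  qed
  have "poly (pderiv ?H) 0 = - c * x\<^sub>1 * poly (root_poly ss) 0" unfolding split by simp
  moreover have "poly (root_poly ss) 0 > 0" using pos by (intro poly_root_poly_pos) auto
  ultimately have "- c > 0" using pos0 x(1)
    by (smt (verit) mult_nonneg_nonneg mult_nonpos_nonneg)
  moreover have "Suc (length ss) = length rs"
  proof -
    have "degree ?H = Suc (length rs)" unfolding H by simp
    then have "degree (pderiv ?H) = length rs" by (simp add: degree_pderiv del: mult_pCons_left)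
    then have "length ts = length rs" unfolding ts using c by simp
    then show ?thesis using in_ts rs_ne by (simp add: ss_def length_remove1)
  qed
  ultimately show ?thesis using that pos split by blast
qed

text \<open>Let \<open>x\<^sub>j\<close> be the largest root of the \<open>j\<close>-th derivative of \<open>H\<close>.  A nonnegative coefficient of
  index \<open>k + 1\<close> forces \<open>x\<^sub>k\<^sub>+\<^sub>1 \<ge> 0\<close>, and since the gaps never shrink, the first one is at most
  \<open>x\<^sub>0 / (k + 1)\<close>.  The conclusion expresses \<open>x\<^sub>1 \<ge> x\<^sub>0 (1 - 1 / (k + 1))\<close> through the sign of \<open>H'\<close>,
  so that the induction, which passes from \<open>H\<close> to \<open>H'\<close>, never has to speak of largest roots.\<close>

lemma peel_largest_roots:
  fixes rs :: "real list"
  assumes "\<And>r. r \<in> set rs \<Longrightarrow> 0 < r" "0 < x\<^sub>0" "Suc k \<le> length rs"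
    and "0 \<le> coeff ([:x\<^sub>0, -1:] * root_poly rs) (Suc k)"
  shows "0 \<le> poly (pderiv ([:x\<^sub>0, -1:] * root_poly rs)) (x\<^sub>0 * (1 - 1 / Suc k))"
  using assms
proof (induction k arbitrary: rs x\<^sub>0)
  case 0
  then show ?case by (simp add: poly_0_coeff_0 coeff_pderiv del: mult_pCons_left)
next
  case (Suc k)
  let ?H = "[:x\<^sub>0, -1:] * root_poly rs"
  note rs = Suc.prems(1) and x0 = Suc.prems(2)
  have coeff_H: "coeff ?H (Suc j) = x\<^sub>0 * coeff (root_poly rs) (Suc j) - coeff (root_poly rs) j" for j
    by (simp add: coeff_pCons)
  have rs_ne: "rs \<noteq> []" using Suc.prems(3) by auto
  \<comment> \<open>A descent already at index 1 would persist, by log-concavity, up to index \<open>k + 2\<close>.\<close>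
  have "coeff ?H 1 > 0"
  proof (rule ccontr)
    assume "\<not> coeff ?H 1 > 0"
    then have "x\<^sub>0 * icoeff (root_poly rs) (0 + 1) \<le> icoeff (root_poly rs) 0"
      using coeff_H[of 0] by (simp add: icoeff_def del: mult_pCons_left)
    moreover have "0 < icoeff (root_poly rs) 0"
      using coeff_root_poly_pos[of rs 0] rs by (simp add: icoeff_def)
    moreover have "0 < icoeff (root_poly rs) (int (Suc (Suc k)))"
      unfolding icoeff_of_nat using rs Suc.prems(3) by (rule coeff_root_poly_pos)
    ultimately have "x\<^sub>0 * icoeff (root_poly rs) (int (Suc (Suc k)))
        < icoeff (root_poly rs) (int (Suc (Suc k)) - 1)"
      using slc_ratio_decreasing[OF slc_root_poly[of rs] x0, of 0 "int (Suc (Suc k))"] rs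
      by (simp add: less_imp_le)
    then have "coeff ?H (Suc (Suc k)) < 0"
      unfolding coeff_H by (simp add: icoeff_def nat_add_distrib)
    with Suc.prems(4) show False by simp
  qed
  then have pos0: "0 < poly (pderiv ?H) 0"
    by (simp add: poly_0_coeff_0 coeff_pderiv del: mult_pCons_left)
  have "poly (pderiv ?H) x\<^sub>0 < 0"
    using poly_pderiv_positive_root_times[of rs x\<^sub>0 x\<^sub>0] poly_root_poly_pos[of rs x\<^sub>0] rs x0
    by (simp add: add_pos_pos del: mult_pCons_left)
  then obtain x\<^sub>1 where x1: "0 < x\<^sub>1" "x\<^sub>1 < x\<^sub>0" and crit: "poly (pderiv ?H) x\<^sub>1 = 0"
    using poly_IVT_neg[OF x0 pos0] by blast
  obtain c ss where c: "c > 0" and ss: "\<And>s. s \<in> set ss \<Longrightarrow> 0 < s" "Suc (length ss) = length rs"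
    and split: "pderiv ?H = smult c ([:x\<^sub>1, -1:] * root_poly ss)"
    using pderiv_split_positive_root[OF rs x1 crit pos0] by blast
  have "c * coeff ([:x\<^sub>1, -1:] * root_poly ss) (Suc k) = coeff (pderiv ?H) (Suc k)"
    unfolding split by simp
  also have "\<dots> \<ge> 0" using Suc.prems(4) by (simp add: coeff_pderiv del: mult_pCons_left)
  finally have "0 \<le> coeff ([:x\<^sub>1, -1:] * root_poly ss) (Suc k)"
    using c by (simp add: zero_le_mult_iff del: mult_pCons_left)
  then have "0 \<le> poly (pderiv ([:x\<^sub>1, -1:] * root_poly ss)) (x\<^sub>1 * (1 - 1 / Suc k))"
    using Suc.IH[OF ss(1) x1(1)] ss(2) Suc.prems(3) by simp
  then have "0 \<le> poly (pderiv (pderiv ?H)) (x\<^sub>1 * (1 - 1 / Suc k))"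
    unfolding split using c by (simp add: pderiv_smult del: mult_pCons_left of_nat_Suc)
  moreover have "(x\<^sub>0 - x\<^sub>1) * (\<Sum>r\<leftarrow>rs. 1 / (x\<^sub>1 + r)) = 1"
    using pderiv_sign_around_critical_point(1)[of rs x\<^sub>1 x\<^sub>0] rs x1 crit by simp
  moreover have "0 \<le> x\<^sub>1 * (1 - 1 / Suc k)" "x\<^sub>1 * (1 - 1 / Suc k) \<le> x\<^sub>1"
    using x1(1) by (simp_all add: field_simps)
  ultimately have "\<not> x\<^sub>1 - x\<^sub>1 * (1 - 1 / Suc k) < x\<^sub>0 - x\<^sub>1"
    using largest_root_gap[of rs "x\<^sub>1 * (1 - 1 / Suc k)" x\<^sub>1 x\<^sub>0] rs_ne rs by (meson not_le)
  then have "x\<^sub>0 * (1 - 1 / Suc (Suc k)) \<le> x\<^sub>1"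
    by (simp add: field_simps)
  moreover have "0 \<le> x\<^sub>0 * (1 - 1 / Suc (Suc k))" using x0 by (simp add: field_simps)
  ultimately show ?case
    using pderiv_sign_around_critical_point(2)[of rs x\<^sub>1 x\<^sub>0] rs x1 crit by simp
qed

text \<open>For \<open>y = 1 - 1 / (k + 1)\<close> the previous lemma with \<open>x\<^sub>0 = 1\<close> yields
  \<open>\<Sum> 1 / (y + r) \<ge> k + 1\<close>, and \<open>1 / (1 + r)\<close> is larger than \<open>y / (y + r)\<close>.  The sum on the right
  of the conclusion is the mean \<open>G'(1) / G(1)\<close>.\<close>

lemma ascent_bounds_mean_roots:
  fixes rs :: "real list"
  assumes rs: "\<And>r. r \<in> set rs \<Longrightarrow> 0 < r" and k: "Suc k \<le> length rs"
    and ascent: "coeff (root_poly rs) k \<le> coeff (root_poly rs) (Suc k)"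
  shows "real k < (\<Sum>r\<leftarrow>rs. 1 / (1 + r))"
proof -
  define y where "y = 1 - 1 / real (Suc k)"
  have y: "0 \<le> y" "y < 1" by (simp_all add: y_def)
  have rs_ne: "rs \<noteq> []" using k by auto
  have "0 \<le> coeff ([:1, -1:] * root_poly rs) (Suc k)"
    using ascent by (simp add: coeff_pCons)
  then have "0 \<le> poly (pderiv ([:1, -1:] * root_poly rs)) y"
    using peel_largest_roots[OF rs, where x\<^sub>0 = 1 and k = k] k by (simp add: y_def del: mult_pCons_left of_nat_Suc)
  then have "0 \<le> poly (root_poly rs) y * ((1 - y) * (\<Sum>r\<leftarrow>rs. 1 / (y + r)) - 1)"
    by (subst (asm) poly_pderiv_positive_root_times) (use rs y in auto)
  moreover have "poly (root_poly rs) y > 0"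
    using rs y by (intro poly_root_poly_pos) (auto intro: add_nonneg_pos)
  ultimately have "1 \<le> (1 - y) * (\<Sum>r\<leftarrow>rs. 1 / (y + r))" by (simp add: zero_le_mult_iff)
  moreover have "1 - y = 1 / real (Suc k)" by (simp add: y_def)
  ultimately have "real (Suc k) \<le> (\<Sum>r\<leftarrow>rs. 1 / (y + r))" by (simp add: field_simps)
  then have "y * real (Suc k) \<le> y * (\<Sum>r\<leftarrow>rs. 1 / (y + r))" using y by (intro mult_left_mono)
  moreover have "y * real (Suc k) = real k" by (simp add: y_def field_simps)
  ultimately have "real k \<le> y * (\<Sum>r\<leftarrow>rs. 1 / (y + r))" by simp
  also have "\<dots> = (\<Sum>r\<leftarrow>rs. y * (1 / (y + r)))" by (simp only: sum_list_const_mult)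
  also have "\<dots> < (\<Sum>r\<leftarrow>rs. 1 / (1 + r))"
  proof (rule sum_list_strict_mono[OF rs_ne])
    fix r assume "r \<in> set rs"
    then have r: "0 < r" by (rule rs)
    have "y * r < r" using y r by simp
    then show "y * (1 / (y + r)) < 1 / (1 + r)"
      using r y by (simp add: divide_less_eq less_divide_eq add_nonneg_pos) (simp add: field_simps)
  qed
  finally show ?thesis .
qed

section \<open>Bernoulli products and Darroch's theorem\<close>

definition bernoulli_poly :: "real list \<Rightarrow> real poly" where
  "bernoulli_poly ps = (\<Prod>p\<leftarrow>ps. [:1 - p, p:])"

lemma bernoulli_poly_Nil [simp]: "bernoulli_poly [] = 1"
  and bernoulli_poly_Cons: "bernoulli_poly (p # ps) = [:1 - p, p:] * bernoulli_poly ps"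
  by (simp_all add: bernoulli_poly_def)

lemma poly_bernoulli_poly_1 [simp]: "poly (bernoulli_poly ps) 1 = 1"
  by (induction ps) (simp_all add: bernoulli_poly_Cons algebra_simps)

lemma poly_pderiv_bernoulli_poly_1: "poly (pderiv (bernoulli_poly ps)) 1 = sum_list ps"
  by (induction ps)
     (simp_all add: bernoulli_poly_Cons pderiv_mult pderiv_pCons del: mult_pCons_left)

lemma icoeff_bernoulli_poly_Cons:
  "icoeff (bernoulli_poly (p # ps)) k =
     (1 - p) * icoeff (bernoulli_poly ps) k + p * icoeff (bernoulli_poly ps) (k - 1)"
  unfolding bernoulli_poly_Cons by (rule icoeff_mult_linear)

lemma slc_bernoulli_poly:
  assumes "set ps \<subseteq> {0..1}"
  shows "strictly_log_concave (icoeff (bernoulli_poly ps))"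
  unfolding bernoulli_poly_def
  using slc_prod_linear[of ps "\<lambda>p. 1 - p" "\<lambda>p. p"] assms by (auto simp: subset_iff)

lemma ascent_bounds_mean_interior:
  assumes "set ps \<subseteq> {0<..<1}" "Suc k \<le> length ps"
    and "coeff (bernoulli_poly ps) k \<le> coeff (bernoulli_poly ps) (Suc k)"
  shows "real k < sum_list ps"
proof -
  define rs where "rs = map (\<lambda>p. (1 - p) / p) ps"
  have "bernoulli_poly ps = smult (prod_list ps) (root_poly rs)"
    using assms(1) unfolding rs_def
  proof (induction ps)
    case (Cons p ps)
    then have "[:1 - p, p:] = smult p [:(1 - p) / p, 1:]" by simp
    then show ?case using Cons
      by (simp add: root_poly_Cons bernoulli_poly_Cons mult.commute del: mult_pCons_left smult_pCons)
  qed simp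
  moreover have "prod_list ps > 0"
    using assms(1) by (induction ps) auto
  ultimately have "coeff (root_poly rs) k \<le> coeff (root_poly rs) (Suc k)"
    using assms(3) by simp
  moreover have "0 < r" if "r \<in> set rs" for r using that assms(1) by (auto simp: rs_def)
  moreover have "Suc k \<le> length rs" using assms(2) by (simp add: rs_def)
  ultimately have "real k < (\<Sum>r\<leftarrow>rs. 1 / (1 + r))" by (intro ascent_bounds_mean_roots)
  also have "(\<Sum>r\<leftarrow>rs. 1 / (1 + r)) = (\<Sum>p\<leftarrow>ps. p)"
    unfolding rs_def map_map o_def
  proof (intro arg_cong[where f = sum_list] map_cong refl)
    fix p assume "p \<in> set ps"
    then have "0 < p" using assms(1) by auto
    then show "1 / (1 + (1 - p) / p) = p" by (simp add: field_simps)
  qed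
  finally show ?thesis by simp
qed

text \<open>Trials with \<open>p = 0\<close> do not matter, and each trial with \<open>p = 1\<close> raises both the index and the
  mean by 1; the remaining factors have a negative root.\<close>

lemma ascent_bounds_mean:
  assumes ps: "set ps \<subseteq> {0..1}" and pos: "icoeff (bernoulli_poly ps) k > 0"
    and ascent: "icoeff (bernoulli_poly ps) (k - 1) \<le> icoeff (bernoulli_poly ps) k"
  shows "real_of_int k - 1 < sum_list ps"
proof -
  define qs where "qs = filter (\<lambda>p. 0 < p \<and> p < 1) ps"
  define j where "j = int (length (filter (\<lambda>p. p = 1) ps))"
  have "icoeff (bernoulli_poly ps) k = icoeff (bernoulli_poly qs) (k - j)" for k
    using ps unfolding qs_def j_def
  proof (induction ps arbitrary: k)
    case (Cons p ps)
    then consider "p = 0" | "p = 1" | "0 < p" "p < 1" by force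
    then show ?case
      using Cons by cases (auto simp: icoeff_bernoulli_poly_Cons algebra_simps)
  qed simp
  note red = this
  have sum: "sum_list ps = real_of_int j + sum_list qs"
    using ps unfolding qs_def j_def by (induction ps) auto
  have qs: "set qs \<subseteq> {0<..<1}" by (auto simp: qs_def)
  have qs_nn: "sum_list qs \<ge> 0" using qs by (intro sum_list_nonneg) auto
  have "k - j \<ge> 0" using pos unfolding red by (auto simp: icoeff_def split: if_splits)
  then consider "k - j = 0" | l where "k - j = int (Suc l)"
    by (metis nonneg_eq_int not0_implies_Suc of_nat_0)
  then show ?thesis
  proof cases
    case 1
    then show ?thesis using sum qs_nn by simp
  next
    case (2 l)
    then have "k - 1 - j = int l" by simp
    then have le: "coeff (bernoulli_poly qs) l \<le> coeff (bernoulli_poly qs) (Suc l)"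
      using ascent unfolding red 2 by (simp only: icoeff_of_nat)
    have "coeff (bernoulli_poly qs) (Suc l) > 0"
      using pos unfolding red 2 by (simp only: icoeff_of_nat)
    then have "Suc l \<le> degree (bernoulli_poly qs)" by (intro le_degree) simp
    also have "\<dots> \<le> length qs"
    proof (induction qs)
      case (Cons p qs)
      have "degree (bernoulli_poly (p # qs)) \<le> degree [:1 - p, p:] + degree (bernoulli_poly qs)"
        unfolding bernoulli_poly_Cons by (rule degree_mult_le)
      also have "degree [:1 - p, p:] \<le> 1" by simp
      finally show ?case using Cons by simp
    qed simp
    finally have "real l < sum_list qs" by (intro ascent_bounds_mean_interior qs le)
    moreover have "real_of_int k = real_of_int j + real l + 1" using 2 by linarith
    ultimately show ?thesis using sum by simp
  qed
qed

lemma icoeff_bernoulli_poly_reverse: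
  "icoeff (bernoulli_poly (map (\<lambda>p. 1 - p) ps)) k = icoeff (bernoulli_poly ps) (int (length ps) - k)"
proof (induction ps arbitrary: k)
  case (Cons p ps)
  have "int (length ps) - k = int (length (p # ps)) - k - 1"
    "int (length ps) - (k - 1) = int (length (p # ps)) - k" by simp_all
  then show ?case unfolding list.map icoeff_bernoulli_poly_Cons Cons.IH by (simp add: algebra_simps)
qed (auto simp: icoeff_def)

lemma icoeff_bernoulli_poly_pos_somewhere:
  assumes "set ps \<subseteq> {0..1}"
  obtains k where "icoeff (bernoulli_poly ps) k > 0"
proof -
  have "bernoulli_poly ps \<noteq> 0" using poly_bernoulli_poly_1[of ps] by fastforce
  then have "icoeff (bernoulli_poly ps) (int (degree (bernoulli_poly ps))) \<noteq> 0" by simp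
  then show ?thesis
    using that slc_nonneg[OF slc_bernoulli_poly[OF assms]] by (metis order_le_less)
qed

text \<open>A mode is an ascent from the left, which bounds the mean from below, and after exchanging
  successes and failures also from above.\<close>

theorem darroch:
  assumes ps: "set ps \<subseteq> {0..1}"
    and mode: "\<And>j. icoeff (bernoulli_poly ps) j \<le> icoeff (bernoulli_poly ps) k"
  shows "\<bar>real_of_int k - sum_list ps\<bar> < 1"
proof -
  have pos: "icoeff (bernoulli_poly ps) k > 0"
    using icoeff_bernoulli_poly_pos_somewhere[OF ps] mode by (meson less_le_trans)
  have "real_of_int k - 1 < sum_list ps" by (rule ascent_bounds_mean[OF ps pos mode])
  moreover
  let ?qs = "map (\<lambda>p. 1 - p) ps" and ?k = "int (length ps) - k"
  have "real_of_int ?k - 1 < sum_list ?qs"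
    by (rule ascent_bounds_mean) (use ps pos mode in \<open>auto simp: icoeff_bernoulli_poly_reverse\<close>)
  moreover have "sum_list ?qs = real (length ps) - sum_list ps"
    by (induction ps) auto
  ultimately show ?thesis by (simp add: abs_less_iff)
qed

text \<open>A factor \<open>z + r\<close> is \<open>1 + r\<close> times \<open>1 - p + p z\<close> for \<open>p = 1 / (1 + r)\<close>, and the scalars are
  collected by evaluation at 1.\<close>

lemma nonpos_rooted_imp_bernoulli_poly:
  fixes q :: "real poly"
  assumes roots: "\<And>z. poly (map_poly complex_of_real q) z = 0 \<Longrightarrow> \<exists>r\<ge>0. z = - complex_of_real r"
    and q1: "poly q 1 > 0"
  obtains ps where "set ps \<subseteq> {0..1}" "q = smult (poly q 1) (bernoulli_poly ps)"
proof -
  have "q \<noteq> 0" using q1 by auto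
  moreover have "z \<in> \<real>" if "poly (map_poly complex_of_real q) z = 0" for z
    using roots[OF that] by auto
  ultimately obtain c rs where c: "c \<noteq> 0" and q: "q = smult c (root_poly rs)"
    using real_rooted_factorization by blast
  have rs: "0 \<le> r" if "r \<in> set rs" for r
  proof -
    have "poly (map_poly complex_of_real q) (complex_of_real (- r)) = complex_of_real (poly q (- r))"
      by (rule poly_map_poly_of_real)
    also have "poly q (- r) = 0" using that by (simp add: q poly_root_poly_eq_0_iff)
    finally obtain s where "s \<ge> 0" "complex_of_real (- r) = - complex_of_real s"
      using roots[of "complex_of_real (- r)"] by auto
    then show ?thesis by simp
  qed
  define ps where "ps = map (\<lambda>r. 1 / (1 + r)) rs"
  have "root_poly rs = smult (\<Prod>r\<leftarrow>rs. 1 + r) (bernoulli_poly ps)"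
    unfolding ps_def using rs
  proof (induction rs)
    case (Cons r rs)
    have "1 + r \<noteq> 0" using Cons.prems[of r] by simp
    then have "[:r, 1:] = smult (1 + r) [:1 - 1 / (1 + r), 1 / (1 + r):]"
      by (simp add: field_simps)
    then show ?case using Cons
      by (simp add: root_poly_Cons bernoulli_poly_Cons mult.commute del: mult_pCons_left smult_pCons)
  qed simp
  then obtain d where d: "q = smult d (bernoulli_poly ps)" unfolding q by auto
  then have "poly q 1 = d" by simp
  moreover have "1 / (1 + r) \<in> {0..1}" if "r \<in> set rs" for r
    using rs[OF that] by (simp add: divide_le_eq)
  then have "set ps \<subseteq> {0..1}" unfolding ps_def set_map by blast
  ultimately show ?thesis using that d by blast
qed

section \<open>Even and odd parts\<close>

text \<open>Beyond index \<open>degree q\<close> all coefficients of the two parts vanish, so a list of length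
  \<open>degree q + 1\<close> holds all of them.\<close>

definition even_part :: "'a::zero poly \<Rightarrow> 'a poly" where
  "even_part q = Poly (map (\<lambda>k. coeff q (2 * k)) [0..<Suc (degree q)])"

definition odd_part :: "'a::zero poly \<Rightarrow> 'a poly" where
  "odd_part q = Poly (map (\<lambda>k. coeff q (2 * k + 1)) [0..<Suc (degree q)])"

lemma coeff_even_part [simp]: "coeff (even_part q) k = coeff q (2 * k)"
  by (cases "k \<le> degree q")
     (auto simp: even_part_def nth_default_def coeff_eq_0 simp del: upt_Suc)

lemma coeff_odd_part [simp]: "coeff (odd_part q) k = coeff q (2 * k + 1)"
  by (cases "k \<le> degree q")
     (auto simp: odd_part_def nth_default_def coeff_eq_0 simp del: upt_Suc)

lemma poly_even_odd_split:
  fixes q :: "'a::comm_ring_1 poly"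
  shows "poly q z = poly (even_part q) (z\<^sup>2) + z * poly (odd_part q) (z\<^sup>2)"
proof (induction q)
  case (pCons a q)
  have "even_part (pCons a q) = pCons a (odd_part q)"
    by (rule poly_eqI) (auto simp: coeff_pCons split: nat.splits)
  moreover have "odd_part (pCons a q) = even_part q"
    by (rule poly_eqI) (simp add: coeff_pCons)
  ultimately show ?case using pCons by (simp add: algebra_simps power2_eq_square)
qed (simp_all add: even_part_def odd_part_def)

text \<open>Only the mixed terms of \<open>|a + b|\<^sup>2\<close> change sign under \<open>z \<mapsto> -z\<close>, where \<open>b = T z\<close>.\<close>

lemma norm_quadratic_reflect:
  fixes L T W :: real and z :: complex
  shows "(cmod (of_real L + of_real T * z + of_real W * z\<^sup>2))\<^sup>2 =
     (cmod (of_real L - of_real T * z + of_real W * z\<^sup>2))\<^sup>2 + 4 * T * Re z * (L + W * (cmod z)\<^sup>2)"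
  unfolding cmod_power2 by (simp add: power2_eq_square algebra_simps)

text \<open>A strict inequality for one factor survives in the product because the right-hand factors have
  no zeros in the open right half-plane.\<close>

lemma half_plane_domination:
  fixes L T W :: "nat \<Rightarrow> real" and z :: complex
  assumes fin: "finite I"
    and nn: "\<And>i. i \<in> I \<Longrightarrow> L i \<ge> 0 \<and> T i \<ge> 0 \<and> W i \<ge> 0 \<and> L i + T i + W i > 0"
    and z: "Re z > 0" and i: "i \<in> I" "T i > 0" "L i + W i > 0"
  shows "cmod (\<Prod>i\<in>I. of_real (L i) - of_real (T i) * z + of_real (W i) * z\<^sup>2)
       < cmod (\<Prod>i\<in>I. of_real (L i) + of_real (T i) * z + of_real (W i) * z\<^sup>2)"
proof -
  let ?p = "\<lambda>i. cmod (of_real (L i) + of_real (T i) * z + of_real (W i) * z\<^sup>2)"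
  let ?m = "\<lambda>i. cmod (of_real (L i) - of_real (T i) * z + of_real (W i) * z\<^sup>2)"
  have z0: "z \<noteq> 0" using z by auto
  have eq: "(?p j)\<^sup>2 = (?m j)\<^sup>2 + 4 * T j * Re z * (L j + W j * (cmod z)\<^sup>2)" if "j \<in> I" for j
    by (rule norm_quadratic_reflect)
  have nonneg: "0 \<le> 4 * T j * Re z * (L j + W j * (cmod z)\<^sup>2)" if "j \<in> I" for j
    using nn[OF that] z by simp
  have strict: "0 < 4 * T j * Re z * (L j + W j * (cmod z)\<^sup>2)"
    if "j \<in> I" "T j > 0" "L j + W j > 0" for j
  proof -
    have "L j > 0 \<or> W j > 0" using nn[OF that(1)] that(3) by linarith
    then have "L j + W j * (cmod z)\<^sup>2 > 0" using nn[OF that(1)] z0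
      by (auto intro: add_pos_nonneg add_nonneg_pos)
    then show ?thesis using that z by simp
  qed
  have le: "?m j \<le> ?p j" if "j \<in> I" for j
  proof (rule power2_le_imp_le)
    show "(?m j)\<^sup>2 \<le> (?p j)\<^sup>2" using eq[OF that] nonneg[OF that] by linarith
  qed simp
  have pos: "?p j > 0" if j: "j \<in> I" for j
  proof -
    consider "T j > 0" "L j + W j > 0" | "T j > 0" "L j = 0" "W j = 0" | "T j = 0"
      using nn[OF j] by fastforce
    then show ?thesis
    proof cases
      case 1
      then have "(?p j)\<^sup>2 > 0"
        using eq[OF j] strict[OF j] zero_le_power2[of "?m j"] by linarith
      then show ?thesis by (simp only: zero_less_power2) simp
    next
      case 2
      then show ?thesis using z0 by simp
    next
      case 3
      have "of_real (L j) + of_real (W j) * z\<^sup>2 \<noteq> 0"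
      proof
        assume *: "of_real (L j) + of_real (W j) * z\<^sup>2 = 0"
        have "Im (of_real (L j) + of_real (W j) * z\<^sup>2) = W j * (2 * Re z * Im z)"
          by (simp add: power2_eq_square)
        moreover have "Re (of_real (L j) + of_real (W j) * z\<^sup>2) = L j + W j * ((Re z)\<^sup>2 - (Im z)\<^sup>2)"
          by (simp add: power2_eq_square)
        ultimately have 0: "W j = 0 \<or> Im z = 0" "L j + W j * ((Re z)\<^sup>2 - (Im z)\<^sup>2) = 0"
          using * z by auto
        have LW: "L j \<ge> 0" "W j \<ge> 0" "L j > 0 \<or> W j > 0" using nn[OF j] 3 by auto
        show False
        proof (cases "W j = 0")
          case False
          then have "W j * (Re z)\<^sup>2 > 0" using LW z by simp
          then show False using 0 False LW by simp
        qed (use 0 LW in simp)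
      qed
      then show ?thesis using 3 by simp
    qed
  qed
  have strict_i: "?m i < ?p i"
  proof (rule power2_less_imp_less)
    show "(?m i)\<^sup>2 < (?p i)\<^sup>2" using eq[OF i(1)] strict[OF i] by linarith
  qed simp
  have "(\<Prod>j\<in>I. ?m j) = ?m i * (\<Prod>j\<in>I - {i}. ?m j)" using fin i by (simp add: prod.remove)
  also have "\<dots> \<le> ?m i * (\<Prod>j\<in>I - {i}. ?p j)"
    using le by (intro mult_left_mono prod_mono) auto
  also have "\<dots> < ?p i * (\<Prod>j\<in>I - {i}. ?p j)"
    using strict_i pos by (intro mult_strict_right_mono prod_pos) auto
  also have "\<dots> = (\<Prod>j\<in>I. ?p j)" using fin i by (simp add: prod.remove)
  finally show ?thesis by (simp add: prod_norm)
qed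

text \<open>If \<open>z\<^sup>2\<close> is a root of the even or of the odd part, then \<open>G(z)\<close> and \<open>G(-z)\<close> have the same
  modulus, so the square root of \<open>w\<close> with nonnegative real part has to be purely imaginary.  The
  parity hypothesis supplies a factor with \<open>0 < T\<^sub>i < 1\<close>, for which the domination is strict.\<close>

lemma hermite_biehler_even_odd:
  fixes L T W :: "nat \<Rightarrow> real"
  assumes fin: "finite I"
    and nn: "\<And>i. i \<in> I \<Longrightarrow> L i \<ge> 0 \<and> T i \<ge> 0 \<and> W i \<ge> 0 \<and> L i + T i + W i = 1"
    and parity: "\<bar>\<Prod>i\<in>I. 1 - 2 * T i\<bar> < 1"
    and q: "q = even_part (\<Prod>i\<in>I. [:L i, T i, W i:]) \<or> q = odd_part (\<Prod>i\<in>I. [:L i, T i, W i:])"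
    and root: "poly (map_poly complex_of_real q) w = 0"
  shows "\<exists>r\<ge>0. w = - complex_of_real r"
proof -
  let ?G = "\<Prod>i\<in>I. [:L i, T i, W i:]"
  define G where "G = map_poly complex_of_real ?G"
  have G: "poly G z = (\<Prod>i\<in>I. of_real (L i) + of_real (T i) * z + of_real (W i) * z\<^sup>2)" for z
  proof -
    have "G = (\<Prod>i\<in>I. map_poly complex_of_real [:L i, T i, W i:])"
      unfolding G_def using fin by (induction I) (simp_all add: map_poly_of_real_mult del: mult_pCons_left)
    then show ?thesis
      by (simp add: poly_prod map_poly_pCons algebra_simps power2_eq_square)
  qed
  obtain i where i: "i \<in> I" "T i > 0" "L i + W i > 0"
  proof (rule ccontr)
    assume "\<not> thesis"
    then have "T i = 0 \<or> L i + W i = 0" if "i \<in> I" for i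
      using that nn[of i] \<open>\<And>i. i \<in> I \<Longrightarrow> 0 < T i \<Longrightarrow> 0 < L i + W i \<Longrightarrow> thesis\<close> by force
    then have "\<bar>1 - 2 * T i\<bar> = 1" if "i \<in> I" for i using that nn[of i] by force
    then have "(\<Prod>i\<in>I. \<bar>1 - 2 * T i\<bar>) = 1" by simp
    with parity show False by (simp add: abs_prod)
  qed
  define z where "z = csqrt w"
  have z: "z\<^sup>2 = w" by (simp add: z_def)
  have even: "map_poly complex_of_real (even_part p) = even_part (map_poly complex_of_real p)"
    and odd: "map_poly complex_of_real (odd_part p) = odd_part (map_poly complex_of_real p)" for p
    by (rule poly_eqI, simp add: coeff_map_poly)+
  have "poly (even_part G) (z\<^sup>2) = 0 \<or> poly (odd_part G) (z\<^sup>2) = 0"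
    using root q unfolding z G_def even[symmetric] odd[symmetric] by blast
  moreover have "poly G z = poly (even_part G) (z\<^sup>2) + z * poly (odd_part G) (z\<^sup>2)"
    "poly G (- z) = poly (even_part G) (z\<^sup>2) - z * poly (odd_part G) (z\<^sup>2)"
    using poly_even_odd_split[of G z] poly_even_odd_split[of G "- z"] by simp_all
  ultimately have "cmod (poly G (- z)) = cmod (poly G z)" by auto
  moreover have "cmod (poly G (- z)) < cmod (poly G z)" if "Re z > 0"
    using half_plane_domination[of I L T W z i] fin that i nn by (simp add: G)
  ultimately have "\<not> Re z > 0" by auto
  moreover have "Re z \<ge> 0" using csqrt_principal[of w] by (auto simp: z_def)
  ultimately have "Re z = 0" by simp
  then have "z = \<i> * complex_of_real (Im z)" by (simp add: complex_eq_iff)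
  then have "z\<^sup>2 = (\<i> * complex_of_real (Im z))\<^sup>2" by (rule arg_cong)
  also have "\<dots> = - complex_of_real ((Im z)\<^sup>2)" by (simp add: power_mult_distrib)
  finally have "w = - complex_of_real ((Im z)\<^sup>2)" unfolding z .
  then show ?thesis by (intro exI[of _ "(Im z)\<^sup>2"]) simp
qed

section \<open>Conditioning on parity moves the mean by at most one half\<close>

text \<open>Let \<open>\<rho> = G(-1)\<close> and \<open>D = G'(-1) + \<rho> G'(1)\<close>.  A further factor, with \<open>u = 1 - 2 T\<close>, replaces
  \<open>\<rho>\<close> by \<open>u \<rho>\<close> and \<open>D\<close> by \<open>u D + 2 \<rho> T (L - W)\<close>.  Since \<open>|L - W| \<le> 1 - T\<close> and
  \<open>2 T (1 - T) \<le> 1 - |u|\<close>, the bound \<open>1 - |\<rho>|\<close> is inherited.\<close>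

lemma parity_mean_discrepancy:
  fixes L T W :: "nat \<Rightarrow> real"
  assumes "finite I"
    and "\<And>i. i \<in> I \<Longrightarrow> L i \<ge> 0 \<and> T i \<ge> 0 \<and> W i \<ge> 0 \<and> L i + T i + W i = 1"
  defines "G \<equiv> (\<Prod>i\<in>I. [:L i, T i, W i:])"
  shows "\<bar>poly (pderiv G) (-1) + poly G (-1) * poly (pderiv G) 1\<bar> \<le> 1 - \<bar>poly G (-1)\<bar>"
  using assms(1,2) unfolding G_def
proof (induction I)
  case (insert i I)
  let ?G = "\<Prod>i\<in>I. [:L i, T i, W i:]"
  define \<rho> D u where "\<rho> = poly ?G (-1)"
    and "D = poly (pderiv ?G) (-1) + poly ?G (-1) * poly (pderiv ?G) 1" and "u = 1 - 2 * T i"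
  have i: "L i \<ge> 0" "T i \<ge> 0" "W i \<ge> 0" "L i = 1 - T i - W i"
    using insert.prems[of i] by auto
  have G1: "poly ?G 1 = 1"
    using insert.prems by (simp add: poly_prod algebra_simps)
  have IH: "\<bar>D\<bar> \<le> 1 - \<bar>\<rho>\<bar>" unfolding D_def \<rho>_def using insert by simp
  have new: "poly ([:L i, T i, W i:] * ?G) (-1) = u * \<rho>"
    by (simp add: i(4) u_def \<rho>_def algebra_simps)
  have "poly (pderiv ([:L i, T i, W i:] * ?G)) (-1)
      + poly ([:L i, T i, W i:] * ?G) (-1) * poly (pderiv ([:L i, T i, W i:] * ?G)) 1
      = u * D + 2 * \<rho> * T i * (L i - W i)"
    unfolding new by (simp only: pderiv_mult poly_add poly_mult G1)
      (simp add: pderiv_pCons D_def \<rho>_def u_def i(4) algebra_simps)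
  also have "\<bar>\<dots>\<bar> \<le> \<bar>u\<bar> * \<bar>D\<bar> + \<bar>\<rho>\<bar> * (2 * T i * \<bar>L i - W i\<bar>)"
    using i by (intro order_trans[OF abs_triangle_ineq]) (simp add: abs_mult)
  also have "\<dots> \<le> \<bar>u\<bar> * (1 - \<bar>\<rho>\<bar>) + \<bar>\<rho>\<bar> * (1 - \<bar>u\<bar>)"
  proof (intro add_mono mult_left_mono IH)
    have "2 * T i * \<bar>L i - W i\<bar> \<le> 2 * T i * (1 - T i)"
      using i by (intro mult_left_mono) auto
    also have "\<dots> \<le> 1 - \<bar>u\<bar>"
      using i mult_left_le[of "T i" "T i"] mult_left_le[of "1 - T i" "T i"]
        mult_left_le[of "T i" "1 - T i"] by (auto simp: u_def abs_if algebra_simps)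
    finally show "2 * T i * \<bar>L i - W i\<bar> \<le> 1 - \<bar>u\<bar>" .
  qed auto
  also have "\<dots> \<le> 1 - \<bar>u * \<rho>\<bar>"
  proof -
    have "\<bar>u\<bar> \<le> 1" using i by (auto simp: u_def)
    moreover have "\<bar>\<rho>\<bar> \<le> 1" using IH by linarith
    ultimately have "0 \<le> (1 - \<bar>u\<bar>) * (1 - \<bar>\<rho>\<bar>)" by (intro mult_nonneg_nonneg) auto
    then show ?thesis by (simp add: abs_mult algebra_simps)
  qed
  finally show ?case using insert.hyps new by simp
qed simp

text \<open>Both identities come from differentiating \<open>G(z) = E(z\<^sup>2) + z O(z\<^sup>2)\<close> at 1 and at \<open>-1\<close>.\<close>

lemma poly_pderiv_even_odd:
  fixes q :: "real poly"
  shows "4 * poly (pderiv (even_part q)) 1 = poly (pderiv q) 1 - poly (pderiv q) (-1)"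
    and "4 * poly (pderiv (odd_part q)) 1 + 2 * poly (odd_part q) 1
      = poly (pderiv q) 1 + poly (pderiv q) (-1)"
proof -
  have "q = pcompose (even_part q) [:0, 0, 1:] + [:0, 1:] * pcompose (odd_part q) [:0, 0, 1:]"
    by (rule poly_ext) (subst poly_even_odd_split, simp add: poly_pcompose power2_eq_square)
  then have "pderiv q = pderiv (pcompose (even_part q) [:0, 0, 1:]
      + [:0, 1:] * pcompose (odd_part q) [:0, 0, 1:])" by (rule arg_cong)
  then have "poly (pderiv q) z = 2 * z * poly (pderiv (even_part q)) (z\<^sup>2)
     + poly (odd_part q) (z\<^sup>2) + 2 * z\<^sup>2 * poly (pderiv (odd_part q)) (z\<^sup>2)" for z
    by (simp add: pderiv_add pderiv_mult pderiv_pcompose pderiv_pCons poly_pcompose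
        power2_eq_square algebra_simps)
  from this[of 1] this[of "-1"]
  show "4 * poly (pderiv (even_part q)) 1 = poly (pderiv q) 1 - poly (pderiv q) (-1)"
    "4 * poly (pderiv (odd_part q)) 1 + 2 * poly (odd_part q) 1
      = poly (pderiv q) 1 + poly (pderiv q) (-1)" by simp_all
qed

lemma parity_conditional_means:
  fixes L T W :: "nat \<Rightarrow> real"
  assumes "finite I"
    and "\<And>i. i \<in> I \<Longrightarrow> L i \<ge> 0 \<and> T i \<ge> 0 \<and> W i \<ge> 0 \<and> L i + T i + W i = 1"
  defines "G \<equiv> (\<Prod>i\<in>I. [:L i, T i, W i:])"
  assumes pos: "poly (even_part G) 1 > 0" "poly (odd_part G) 1 > 0"
  shows "\<bar>poly (pderiv (even_part G)) 1 / poly (even_part G) 1 - poly (pderiv G) 1 / 2\<bar> \<le> 1/2"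
    and "\<bar>poly (pderiv (odd_part G)) 1 / poly (odd_part G) 1 + 1/2 - poly (pderiv G) 1 / 2\<bar> \<le> 1/2"
proof -
  define \<rho> D where "\<rho> = poly G (-1)" and "D = poly (pderiv G) (-1) + \<rho> * poly (pderiv G) 1"
  have D: "\<bar>D\<bar> \<le> 1 - \<bar>\<rho>\<bar>"
    using parity_mean_discrepancy[of I L T W] assms(1,2) unfolding D_def \<rho>_def G_def by blast
  have "poly G 1 = 1" unfolding G_def using assms(2) by (simp add: poly_prod algebra_simps)
  then have E: "2 * poly (even_part G) 1 = 1 + \<rho>" and O: "2 * poly (odd_part G) 1 = 1 - \<rho>"
    using poly_even_odd_split[of G 1] poly_even_odd_split[of G "-1"] by (simp_all add: \<rho>_def)
  have "poly (pderiv (even_part G)) 1 / poly (even_part G) 1 - poly (pderiv G) 1 / 2 = - D / (2 * (1 + \<rho>))"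
  proof -
    have D_eq: "D = (1 + \<rho>) * poly (pderiv G) 1 - 4 * poly (pderiv (even_part G)) 1"
      using poly_pderiv_even_odd(1)[of G] by (simp add: D_def algebra_simps)
    show ?thesis unfolding D_eq E[symmetric] using pos(1) by (simp add: field_simps)
  qed
  moreover have "\<bar>- D / (2 * (1 + \<rho>))\<bar> \<le> 1/2"
    using D E pos(1) by (simp add: abs_mult field_simps)
  ultimately show "\<bar>poly (pderiv (even_part G)) 1 / poly (even_part G) 1 - poly (pderiv G) 1 / 2\<bar> \<le> 1/2"
    by simp
  have "poly (pderiv (odd_part G)) 1 / poly (odd_part G) 1 + 1/2 - poly (pderiv G) 1 / 2 = D / (2 * (1 - \<rho>))"
  proof -
    have D_eq: "D = 4 * poly (pderiv (odd_part G)) 1 + 2 * poly (odd_part G) 1 - (1 - \<rho>) * poly (pderiv G) 1"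
      using poly_pderiv_even_odd(2)[of G] by (simp add: D_def algebra_simps)
    show ?thesis unfolding D_eq O[symmetric] using pos(2) by (simp add: field_simps)
  qed
  moreover have "\<bar>D / (2 * (1 - \<rho>))\<bar> \<le> 1/2"
    using D O pos(2) by (simp add: abs_mult field_simps)
  ultimately show "\<bar>poly (pderiv (odd_part G)) 1 / poly (odd_part G) 1 + 1/2 - poly (pderiv G) 1 / 2\<bar> \<le> 1/2"
    by simp
qed

section \<open>Distributions with finitely many atoms on a lattice\<close>

text \<open>The generating function of the law of \<open>x - c\<close> under \<open>D\<close> is \<open>q\<close>; the normalisation
  \<open>poly q 1 = 1\<close> leaves no mass outside the atoms listed.\<close>

definition has_pgf :: "real measure \<Rightarrow> real \<Rightarrow> real poly \<Rightarrow> bool" where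
  "has_pgf D c q \<longleftrightarrow> prob_space D \<and> sets D = sets borel \<and> poly q 1 = 1 \<and>
     (\<forall>k. measure D {real k + c} = coeff q k)"

lemma has_pgf_atoms:
  assumes "has_pgf D c q"
  defines "F \<equiv> (\<lambda>k. real k + c) ` {..degree q}"
  shows "prob_space D" "sets D = sets borel" "space D = UNIV"
    and "AE x in D. x \<in> F" "measure D F = 1"
proof -
  show D: "prob_space D" and S: "sets D = sets borel" using assms(1) by (auto simp: has_pgf_def)
  show "space D = UNIV" using sets_eq_imp_space_eq[OF S] by simp
  interpret prob_space D by fact
  have fin: "finite F" by (simp add: F_def)
  have "measure D F = (\<Sum>x\<in>F. measure D {x})"
    using fin S by (intro finite_measure_eq_sum_singleton) auto
  also have "\<dots> = (\<Sum>k\<le>degree q. coeff q k)"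
    unfolding F_def using assms(1) by (subst sum.reindex) (auto simp: inj_on_def has_pgf_def)
  also have "\<dots> = 1" using assms(1) by (simp add: has_pgf_def poly_altdef)
  finally show "measure D F = 1" .
  moreover have "F \<in> sets D" unfolding S using fin by (intro borel_closed finite_imp_closed)
  ultimately show "AE x in D. x \<in> F" using prob_eq_1 by blast
qed

lemma has_pgf_measure_singleton:
  assumes "has_pgf D c q"
  shows "measure D {of_int k + c} = icoeff q k"
    and "y \<notin> int_lattice c \<Longrightarrow> measure D {y} = 0"
proof -
  interpret prob_space D using has_pgf_atoms(1)[OF assms] .
  have off: "measure D {y} = 0" if "y \<notin> (\<lambda>k. real k + c) ` {..degree q}" for y
  proof -
    have "AE x in D. x \<notin> {y}" using has_pgf_atoms(4)[OF assms] by (rule eventually_mono) (use that in auto)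
    then show ?thesis using prob_eq_0[of "{y}"] has_pgf_atoms(2)[OF assms] by simp
  qed
  show "measure D {of_int k + c} = icoeff q k"
  proof (cases "k < 0")
    case True
    then have "of_int k + c \<notin> (\<lambda>k. real k + c) ` {..degree q}" by auto
    then show ?thesis using off True by (simp add: icoeff_def)
  next
    case False
    then obtain n where "k = int n" using nonneg_int_cases[of k] by auto
    then show ?thesis using assms unfolding has_pgf_def by simp
  qed
  have "(\<lambda>k. real k + c) ` {..degree q} \<subseteq> int_lattice c"
    unfolding int_lattice_def
  proof safe
    show "real k + c \<in> range (\<lambda>k. of_int k + c)" for k
      by (rule image_eqI[where x = "int k"]) auto
  qed
  then show "measure D {y} = 0" if "y \<notin> int_lattice c" using off that by blast
qed

lemma has_pgf_integral:
  fixes g :: "real \<Rightarrow> real"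
  assumes D: "has_pgf D c q" and g: "g \<in> borel_measurable borel"
  shows "(\<integral>x. g x \<partial>D) = (\<Sum>k\<le>degree q. coeff q k * g (real k + c))"
proof -
  interpret prob_space D using has_pgf_atoms(1)[OF D] .
  let ?F = "(\<lambda>k. real k + c) ` {..degree q}"
  have sets: "sets D = sets borel" by (rule has_pgf_atoms(2)[OF D])
  have meas: "borel_measurable D = borel_measurable borel"
    by (rule measurable_cong_sets[OF sets refl])
  have "(\<integral>x. g x \<partial>D) = (\<integral>x. (\<Sum>a\<in>?F. g a * indicator {a} x) \<partial>D)"
  proof (rule integral_cong_AE)
    have "g x = (\<Sum>a\<in>?F. g a * indicator {a} x)" if "x \<in> ?F" for x
    proof -
      have "(\<Sum>a\<in>?F. g a * indicator {a} x) = (\<Sum>a\<in>?F. if x = a then g a else 0)"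
        by (intro sum.cong) (auto simp: indicator_def)
      also have "\<dots> = g x" using that by (simp only: sum.delta' finite_imageI finite_atMost if_True)
      finally show ?thesis ..
    qed
    then show "AE x in D. g x = (\<Sum>a\<in>?F. g a * indicator {a} x)"
      using has_pgf_atoms(4)[OF D] by (rule eventually_mono[rotated]) blast
    show "g \<in> borel_measurable D" using g by (simp only: meas)
    show "(\<lambda>x. \<Sum>a\<in>?F. g a * indicator {a} x) \<in> borel_measurable D"
      unfolding meas by (intro borel_measurable_sum borel_measurable_times borel_measurable_const
          borel_measurable_indicator) simp
  qed
  also have "\<dots> = (\<Sum>a\<in>?F. \<integral>x. g a * indicator {a} x \<partial>D)"
    using sets by (intro Bochner_Integration.integral_sum integrable_mult_right integrable_real_indicator)
      (simp_all add: emeasure_eq_measure)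
  also have "\<dots> = (\<Sum>a\<in>?F. g a * measure D {a})"
    using has_pgf_atoms(3)[OF \<open>has_pgf D c q\<close>] by simp
  also have "\<dots> = (\<Sum>k\<le>degree q. coeff q k * g (real k + c))"
    using D by (subst sum.reindex) (auto simp: inj_on_def has_pgf_def mult.commute)
  finally show ?thesis .
qed

lemma has_pgf_mean:
  assumes "has_pgf D c q"
  shows "(\<integral>x. x \<partial>D) = poly (pderiv q) 1 + c"
proof -
  have "(\<integral>x. x \<partial>D) = (\<Sum>k\<le>degree q. coeff q k * (real k + c))"
    by (rule has_pgf_integral[OF assms]) simp
  also have "\<dots> = (\<Sum>k\<le>degree q. real k * coeff q k + c * coeff q k)"
    by (intro sum.cong refl) (simp add: distrib_left mult.commute)
  also have "\<dots> = (\<Sum>k\<le>degree q. real k * coeff q k) + c * (\<Sum>k\<le>degree q. coeff q k)"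
    by (simp only: sum.distrib sum_distrib_left)
  also have "(\<Sum>k\<le>degree q. coeff q k) = 1"
    using assms by (simp add: has_pgf_def poly_altdef)
  also have "(\<Sum>k\<le>degree q. real k * coeff q k) = poly (pderiv q) 1"
  proof (induction q)
    case (pCons a q)
    show ?case
    proof (cases "q = 0")
      case False
      have "(\<Sum>k\<le>Suc (degree q). real k * coeff (pCons a q) k) =
          (\<Sum>k\<le>degree q. real k * coeff q k + coeff q k)"
        unfolding sum.atMost_Suc_shift
        by (simp del: sum.distrib) (intro sum.cong refl, simp add: distrib_right)
      also have "\<dots> = poly (pderiv q) 1 + poly q 1"
        unfolding sum.distrib pCons.IH by (simp add: poly_altdef)
      finally show ?thesis using False by (simp add: pderiv_pCons degree_pCons_eq)
    qed (simp add: pderiv_pCons)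
  qed simp
  finally show ?thesis by simp
qed

text \<open>Both integrals of an indicator are the same finite sum.\<close>

lemma has_pgf_unique:
  assumes "has_pgf D c q" "has_pgf D' c q"
  shows "D = D'"
proof (rule measure_eqI)
  show "sets D = sets D'" using assms by (simp add: has_pgf_def)
  fix A assume "A \<in> sets D"
  then have A: "A \<in> sets borel" using assms by (simp add: has_pgf_def)
  interpret D: prob_space D using has_pgf_atoms(1)[OF assms(1)] .
  interpret D': prob_space D' using has_pgf_atoms(1)[OF assms(2)] .
  have "(\<integral>x. indicator A x \<partial>D) = (\<integral>x. indicator A x \<partial>D' :: real)"
    using A by (simp only: has_pgf_integral[OF assms(1)] has_pgf_integral[OF assms(2)] borel_measurable_indicator)
  then have "measure D A = measure D' A" using has_pgf_atoms(3)[OF assms(1)] has_pgf_atoms(3)[OF assms(2)] by simp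
  then show "emeasure D A = emeasure D' A" by (simp add: D.emeasure_eq_measure D'.emeasure_eq_measure)
qed

section \<open>Poisson binomial distributions\<close>

lemma has_pgf_bernoulli_log_concave:
  assumes D: "has_pgf D c (bernoulli_poly ps)" and ps: "set ps \<subseteq> {0..1}"
  shows "log_concave_distr c D"
proof -
  let ?f = "icoeff (bernoulli_poly ps)"
  note atom = has_pgf_measure_singleton(1)[OF D] and f = slc_bernoulli_poly[OF ps]
  interpret prob_space D by (rule has_pgf_atoms(1)[OF D])
  have "countable (int_lattice c)" unfolding int_lattice_def by simp
  then have meas: "int_lattice c \<in> sets D"
    unfolding has_pgf_atoms(2)[OF D] by (rule sets.countable[rotated]) simp
  have "measure D ((\<lambda>k. real k + c) ` {..degree (bernoulli_poly ps)}) \<le> measure D (int_lattice c)"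
  proof (rule finite_measure_mono[OF _ meas], safe)
    show "real k + c \<in> int_lattice c" for k
      unfolding int_lattice_def by (rule image_eqI[where x = "int k"]) auto
  qed
  then have "measure D (int_lattice c) = 1"
    using has_pgf_atoms(5)[OF D] prob_le_1[of "int_lattice c"] by simp
  moreover have "(measure D {x})\<^sup>2 \<ge> measure D {x - 1} * measure D {x + 1}" if x: "x \<in> int_lattice c" for x
  proof -
    obtain k where k: "x = of_int k + c" using x by (auto simp: int_lattice_def)
    have "x - 1 = of_int (k - 1) + c" "x + 1 = of_int (k + 1) + c" using k by simp_all
    then show ?thesis using slc_log_concave[OF f, of k] by (simp only: k atom)
  qed
  moreover have "measure D {y} > 0"
    if xyz: "x \<in> int_lattice c" "y \<in> int_lattice c" "z \<in> int_lattice c"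
      and *: "x < y \<and> y < z \<and> measure D {x} > 0 \<and> measure D {z} > 0" for x y z
  proof -
    obtain i j k where eq: "x = of_int i + c" "y = of_int j + c" "z = of_int k + c"
      using xyz by (auto simp: int_lattice_def)
    have "i \<le> j" "j \<le> k" "?f i > 0" "?f k > 0" using * unfolding eq atom by simp_all
    then show ?thesis unfolding eq atom by (rule slc_between[OF f])
  qed
  ultimately show ?thesis unfolding log_concave_distr_def by blast
qed

lemma has_pgf_mode_iff:
  assumes D: "has_pgf D c (bernoulli_poly ps)" and ps: "set ps \<subseteq> {0..1}"
  shows "is_mode D x \<longleftrightarrow> (\<exists>k. x = of_int k + c \<and>
     (\<forall>j. icoeff (bernoulli_poly ps) j \<le> icoeff (bernoulli_poly ps) k))"
proof
  let ?f = "icoeff (bernoulli_poly ps)"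
  note atom = has_pgf_measure_singleton(1)[OF D] and off = has_pgf_measure_singleton(2)[OF D]
  {
    assume x: "is_mode D x"
    obtain i where i: "?f i > 0" using icoeff_bernoulli_poly_pos_somewhere[OF ps] .
    have "measure D {of_int i + c} \<le> measure D {x}" using x unfolding is_mode_def by blast
    then have "measure D {x} \<noteq> 0" using i unfolding atom by linarith
    then have "x \<in> int_lattice c" using off by blast
    then obtain k where k: "x = of_int k + c" by (auto simp: int_lattice_def)
    have "?f j \<le> ?f k" for j
      using x unfolding is_mode_def k by (metis atom)
    with k show "\<exists>k. x = of_int k + c \<and> (\<forall>j. ?f j \<le> ?f k)" by blast
  next
    assume "\<exists>k. x = of_int k + c \<and> (\<forall>j. ?f j \<le> ?f k)"
    then obtain k where k: "x = of_int k + c" "\<And>j. ?f j \<le> ?f k" by blast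
    show "is_mode D x" unfolding is_mode_def
    proof
      fix y
      show "measure D {y} \<le> measure D {x}"
      proof (cases "y \<in> int_lattice c")
        case True
        then obtain j where "y = of_int j + c" by (auto simp: int_lattice_def)
        then show ?thesis using k by (simp only: atom)
      qed (use off in simp)
    qed
  }
qed

lemma has_pgf_card_modes:
  assumes D: "has_pgf D c (bernoulli_poly ps)" and ps: "set ps \<subseteq> {0..1}"
  shows "card {x. is_mode D x} \<in> {1, 2}"
proof -
  let ?f = "icoeff (bernoulli_poly ps)"
  define K where "K = {k. \<forall>j. ?f j \<le> ?f k}"
  note f = slc_bernoulli_poly[OF ps]
  obtain i where i: "?f i > 0" using icoeff_bernoulli_poly_pos_somewhere[OF ps] .
  have ex: "\<exists>k. k \<in> K"
  proof -
    define N where "N = int (degree (bernoulli_poly ps))"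
    have zero: "?f k = 0" if "k \<notin> {0..N}" for k
    proof (cases "k < 0")
      case False
      then have "degree (bernoulli_poly ps) < nat k" using that by (simp add: N_def)
      then show ?thesis by (simp add: icoeff_def coeff_eq_0)
    qed (simp add: icoeff_def)
    have "Max (?f ` {0..N}) \<in> ?f ` {0..N}" by (rule Max_in) (simp_all add: N_def)
    then obtain k where k: "Max (?f ` {0..N}) = ?f k" by blast
    have le: "?f j \<le> ?f k" if "j \<in> {0..N}" for j
      unfolding k[symmetric] using that by (intro Max_ge) auto
    have "?f j \<le> ?f k" for j
      using le zero slc_nonneg[OF f, of k] by (cases "j \<in> {0..N}") auto
    then show ?thesis unfolding K_def by blast
  qed
  have adjacent: "l = k + 1" if "k \<in> K" "l \<in> K" "k < l" for k l
    using that i slc_maximizers_adjacent[OF f, of k l] unfolding K_def by (force intro: less_le_trans)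
  obtain k where k: "k \<in> K" using ex by blast
  have "l \<in> {k - 1, k, k + 1}" if "l \<in> K" for l
    using adjacent[OF k that] adjacent[OF that k] by (cases k l rule: linorder_cases) auto
  moreover have "\<not> (k - 1 \<in> K \<and> k + 1 \<in> K)" using adjacent[of "k - 1" "k + 1"] by auto
  ultimately have "K = {k} \<or> K = {k, k + 1} \<or> K = {k - 1, k}" using k by blast
  then have "card K \<in> {1, 2}" by auto
  moreover have "{x. is_mode D x} = (\<lambda>k. of_int k + c) ` K"
    using has_pgf_mode_iff[OF D ps] by (auto simp: K_def)
  then have "card {x. is_mode D x} = card K" by (simp add: card_image inj_on_def)
  ultimately show ?thesis by simp
qed

lemma has_pgf_mode_near_mean:
  assumes D: "has_pgf D c (bernoulli_poly ps)" and ps: "set ps \<subseteq> {0..1}" and x: "is_mode D x"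
  shows "\<bar>x - (\<integral>y. y \<partial>D)\<bar> < 1"
proof -
  obtain k where k: "x = of_int k + c" "\<And>j. icoeff (bernoulli_poly ps) j \<le> icoeff (bernoulli_poly ps) k"
    using x unfolding has_pgf_mode_iff[OF D ps] by blast
  have "\<bar>of_int k - sum_list ps\<bar> < 1" by (rule darroch[OF ps k(2)])
  then show ?thesis unfolding k(1) has_pgf_mean[OF D] poly_pderiv_bernoulli_poly_1 by simp
qed

text \<open>Conditioning on the last trial.\<close>

lemma poisson_binomial_pmf_Suc:
  "poisson_binomial_pmf (Suc m) p =
     bind_pmf (bernoulli_pmf (p m)) (\<lambda>b. map_pmf (\<lambda>x. of_bool b + x) (poisson_binomial_pmf m p))"
proof -
  have step: "(\<Sum>i\<in>insert m {..<m}. of_bool ((f(m := b)) i)) = of_bool b + (\<Sum>i<m. of_bool (f i) :: real)"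
    for f b
  proof -
    have "(\<Sum>i<m. of_bool ((f(m := b)) i)) = (\<Sum>i<m. of_bool (f i) :: real)"
      by (intro sum.cong) auto
    then show ?thesis by (simp add: sum.insert del: sum_of_bool_eq)
  qed
  show ?thesis
    unfolding poisson_binomial_pmf_def lessThan_Suc
    by (subst Pi_pmf_insert', simp, simp)
       (simp only: map_bind_pmf map_return_pmf map_pmf_def bind_assoc_pmf bind_return_pmf step)
qed

lemma pmf_poisson_binomial:
  assumes "\<And>i. i < m \<Longrightarrow> p i \<in> {0..1}"
  shows "pmf (poisson_binomial_pmf m p) (of_int k) = icoeff (\<Prod>i<m. [:1 - p i, p i:]) k"
  using assms
proof (induction m arbitrary: k)
  case 0
  have "poisson_binomial_pmf 0 p = return_pmf 0"
    by (simp add: poisson_binomial_pmf_def)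
  then show ?case by (auto simp: icoeff_def indicator_def)
next
  case (Suc m)
  let ?P = "poisson_binomial_pmf m p" and ?q = "\<Prod>i<m. [:1 - p i, p i:]"
  have shift: "pmf (map_pmf ((+) 1) ?P) (of_int k) = icoeff ?q (k - 1)"
  proof -
    have "pmf (map_pmf ((+) 1) ?P) (1 + of_int (k - 1)) = pmf ?P (of_int (k - 1))"
      by (rule pmf_map_inj') (simp add: inj_on_def)
    moreover have "pmf ?P (of_int (k - 1)) = icoeff ?q (k - 1)"
      by (rule Suc.IH) (use Suc.prems in auto)
    ultimately show ?thesis by simp
  qed
  have zero: "(+) (0::real) = (\<lambda>x. x)" by (simp add: fun_eq_iff)
  have "pmf (poisson_binomial_pmf (Suc m) p) (of_int k) =
      (1 - p m) * icoeff ?q k + p m * icoeff ?q (k - 1)"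
    unfolding poisson_binomial_pmf_Suc pmf_bind using Suc.prems[of m] Suc.IH[of k] Suc.prems shift
    by (simp add: mult.commute zero)
  also have "\<dots> = icoeff (\<Prod>i<Suc m. [:1 - p i, p i:]) k"
    by (simp only: prod.lessThan_Suc mult.commute[of ?q] icoeff_mult_linear)
  finally show ?case .
qed

lemma has_pgf_imp_poisson_binomial:
  assumes D: "has_pgf D 0 (bernoulli_poly ps)" and ps: "set ps \<subseteq> {0..1}"
  shows "poisson_binomial D"
proof -
  define P where "P = poisson_binomial_pmf (length ps) (\<lambda>i. ps ! i)"
  have p: "ps ! i \<in> {0..1}" if "i < length ps" for i using that ps by (meson nth_mem subsetD)
  have "(\<Prod>i<length ps. [:1 - ps ! i, ps ! i:]) = bernoulli_poly ps"
    unfolding bernoulli_poly_def by (simp add: prod.list_conv_set_nth atLeast0LessThan)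
  then have "pmf P (of_int k) = icoeff (bernoulli_poly ps) k" for k
    unfolding P_def using pmf_poisson_binomial[of "length ps" "\<lambda>i. ps ! i" k] p by simp
  from this[of "int _"] have "pmf P (real k) = coeff (bernoulli_poly ps) k" for k by simp
  then have "has_pgf (distr (measure_pmf P) borel (\<lambda>x. x)) 0 (bernoulli_poly ps)"
    unfolding has_pgf_def
    by (auto simp: measure_distr pmf.rep_eq vimage_def intro!: measure_pmf.prob_space_distr)
  then have "D = distr (measure_pmf P) borel (\<lambda>x. x)" using D by (rule has_pgf_unique[rotated])
  then show ?thesis unfolding poisson_binomial_def P_def using p by blast
qed

section \<open>The law of the sum and its conditioning on parity\<close>

lemma icoeff_mult_quadratic:
  "icoeff ([:a, b, c:] * p) k = a * icoeff p k + b * icoeff p (k - 1) + c * icoeff p (k - 2)"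
proof -
  have "[:a, b, c:] * p = [:a, 1:] * ([:0, 0:] * p) + ([:a, b:] * p + [:0, 1:] * ([:0, c:] * p))"
    by (simp add: algebra_simps smult_add_left[symmetric])
  moreover have "icoeff (p + q) k = icoeff p k + icoeff q k" for p q by (simp add: icoeff_def)
  ultimately show ?thesis by (simp add: icoeff_mult_linear del: mult_pCons_left)
qed

text \<open>Doubling moves the half-integers to the integers, where independence turns sums into products
  of generating functions.\<close>

lemma (in prob_space) has_pgf_twice_sum:
  fixes X :: "nat \<Rightarrow> 'a \<Rightarrow> real" and L T W :: "nat \<Rightarrow> real"
  assumes "finite I" "indep_vars (\<lambda>_. borel) X I"
    and "\<And>i. i \<in> I \<Longrightarrow> L i + T i + W i = 1"
    and "\<And>i. i \<in> I \<Longrightarrow> \<P>(\<omega> in M. X i \<omega> = 0) = L i"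
    and "\<And>i. i \<in> I \<Longrightarrow> \<P>(\<omega> in M. X i \<omega> = 1/2) = T i"
    and "\<And>i. i \<in> I \<Longrightarrow> \<P>(\<omega> in M. X i \<omega> = 1) = W i"
  shows "has_pgf (distr M borel (\<lambda>\<omega>. 2 * (\<Sum>i\<in>I. X i \<omega>))) 0 (\<Prod>i\<in>I. [:L i, T i, W i:])"
  using assms
proof (induction I)
  case empty
  have "measure (distr M borel (\<lambda>\<omega>. 0)) {real k} = coeff 1 k" for k
    by (cases "k = 0") (auto simp: measure_return)
  then show ?case by (simp add: has_pgf_def prob_space_return)
next
  case (insert i I)
  define S where "S = (\<lambda>\<omega>. \<Sum>i\<in>I. X i \<omega>)"
  let ?q = "\<Prod>i\<in>I. [:L i, T i, W i:]"
  have rv: "random_variable borel (X j)" if "j \<in> insert i I" for j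
    using insert.prems(1) that unfolding indep_vars_def by blast
  have Xm [measurable]: "X i \<in> borel_measurable M" using rv by simp
  have Sm [measurable]: "S \<in> borel_measurable M" unfolding S_def using rv by simp
  have "indep_vars (\<lambda>_. borel) X I" by (rule indep_vars_subset[OF insert.prems(1)]) auto
  then have IH: "has_pgf (distr M borel (\<lambda>\<omega>. 2 * S \<omega>)) 0 ?q"
    using insert unfolding S_def by simp
  have S_atom: "\<P>(\<omega> in M. 2 * S \<omega> = of_int k) = icoeff ?q k" for k
    using has_pgf_measure_singleton(1)[OF IH, of k]
    by (simp add: measure_distr vimage_def Int_def conj_commute)
  have "indep_var borel (X i) borel S"
    unfolding S_def by (rule indep_vars_sum) (use insert in auto)
  have joint: "\<P>(\<omega> in M. X i \<omega> = x \<and> 2 * S \<omega> = of_int k) = \<P>(\<omega> in M. X i \<omega> = x) * icoeff ?q k" for x k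
  proof -
    have "{\<omega> \<in> space M. X i \<omega> = x \<and> 2 * S \<omega> = of_int k} =
        (\<lambda>\<omega>. (X i \<omega>, S \<omega>)) -` ({x} \<times> {of_int k / 2}) \<inter> space M"
      "{\<omega> \<in> space M. X i \<omega> = x} = X i -` {x} \<inter> space M"
      "{\<omega> \<in> space M. 2 * S \<omega> = of_int k} = S -` {of_int k / 2} \<inter> space M" by auto
    then show ?thesis
      using indep_varD[OF \<open>indep_var borel (X i) borel S\<close>, of "{x}" "{of_int k / 2}"] S_atom[of k]
      by simp
  qed
  have disj: "prob ({\<omega> \<in> space M. P \<omega>} \<union> {\<omega> \<in> space M. Q \<omega>} \<union> {\<omega> \<in> space M. R \<omega>}) =
      \<P>(\<omega> in M. P \<omega>) + \<P>(\<omega> in M. Q \<omega>) + \<P>(\<omega> in M. R \<omega>)"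
    if "{\<omega> \<in> space M. P \<omega>} \<in> events" "{\<omega> \<in> space M. Q \<omega>} \<in> events" "{\<omega> \<in> space M. R \<omega>} \<in> events"
      "\<And>\<omega>. \<not> (P \<omega> \<and> Q \<omega>)" "\<And>\<omega>. \<not> (P \<omega> \<and> R \<omega>)" "\<And>\<omega>. \<not> (Q \<omega> \<and> R \<omega>)" for P Q R
    using that by (subst finite_measure_Union; (subst finite_measure_Union)?) auto
  have supp: "AE \<omega> in M. X i \<omega> = 0 \<or> X i \<omega> = 1/2 \<or> X i \<omega> = 1"
  proof -
    have "prob ({\<omega> \<in> space M. X i \<omega> = 0} \<union> {\<omega> \<in> space M. X i \<omega> = 1/2} \<union> {\<omega> \<in> space M. X i \<omega> = 1}) = 1"
      using insert.prems by (subst disj) auto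
    then have "AE \<omega> in M. \<omega> \<in> {\<omega> \<in> space M. X i \<omega> = 0} \<union> {\<omega> \<in> space M. X i \<omega> = 1/2} \<union> {\<omega> \<in> space M. X i \<omega> = 1}"
      by (subst (asm) prob_eq_1) auto
    then show ?thesis by (rule eventually_mono) auto
  qed
  have "\<P>(\<omega> in M. 2 * (X i \<omega> + S \<omega>) = of_int k) = icoeff ([:L i, T i, W i:] * ?q) k" for k
  proof -
    have "\<P>(\<omega> in M. 2 * (X i \<omega> + S \<omega>) = of_int k) =
      prob ({\<omega> \<in> space M. X i \<omega> = 0 \<and> 2 * S \<omega> = of_int k}
        \<union> {\<omega> \<in> space M. X i \<omega> = 1/2 \<and> 2 * S \<omega> = of_int (k - 1)}
        \<union> {\<omega> \<in> space M. X i \<omega> = 1 \<and> 2 * S \<omega> = of_int (k - 2)})"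
    proof (rule finite_measure_eq_AE)
      show "AE \<omega> in M. \<omega> \<in> {\<omega> \<in> space M. 2 * (X i \<omega> + S \<omega>) = of_int k} \<longleftrightarrow>
        \<omega> \<in> {\<omega> \<in> space M. X i \<omega> = 0 \<and> 2 * S \<omega> = of_int k}
        \<union> {\<omega> \<in> space M. X i \<omega> = 1/2 \<and> 2 * S \<omega> = of_int (k - 1)}
        \<union> {\<omega> \<in> space M. X i \<omega> = 1 \<and> 2 * S \<omega> = of_int (k - 2)}"
        using supp by (rule eventually_mono) auto
    qed measurable
    also have "\<dots> = \<P>(\<omega> in M. X i \<omega> = 0 \<and> 2 * S \<omega> = of_int k)
        + \<P>(\<omega> in M. X i \<omega> = 1/2 \<and> 2 * S \<omega> = of_int (k - 1))
        + \<P>(\<omega> in M. X i \<omega> = 1 \<and> 2 * S \<omega> = of_int (k - 2))"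
      by (rule disj) auto
    also have "\<dots> = L i * icoeff ?q k + T i * icoeff ?q (k - 1) + W i * icoeff ?q (k - 2)"
      unfolding joint using insert.prems(3-5)[of i] by simp
    finally show ?thesis by (simp only: icoeff_mult_quadratic)
  qed
  from this[of "int _"]
  have "\<P>(\<omega> in M. 2 * (X i \<omega> + S \<omega>) = real k) = coeff ([:L i, T i, W i:] * ?q) k" for k
    by (simp del: mult_pCons_left)
  then have "measure (distr M borel (\<lambda>\<omega>. 2 * (X i \<omega> + S \<omega>))) {real k} = coeff ([:L i, T i, W i:] * ?q) k" for k
    by (simp add: measure_distr vimage_def Int_def conj_commute del: mult_pCons_left)
  moreover have "prob_space (distr M borel (\<lambda>\<omega>. 2 * (X i \<omega> + S \<omega>)))"
    by (rule prob_space_distr) measurable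
  moreover have "poly (\<Prod>i\<in>insert i I. [:L i, T i, W i:]) 1 = 1"
    using insert.prems(2) by (simp add: poly_prod add.assoc del: prod.insert)
  ultimately show ?case
    using insert.hyps unfolding has_pgf_def S_def by (simp add: prob_space_distr del: mult_pCons_left)
qed

text \<open>Conditioning on the parity of \<open>2 S\<close> selects every other coefficient of \<open>G\<close>.  The shift \<open>d\<close>
  serves for the conditional laws of both \<open>S\<close> and \<open>S - 1/2\<close>.\<close>

lemma (in prob_space) has_pgf_conditioned:
  fixes S :: "'a \<Rightarrow> real"
  assumes S: "has_pgf (distr M borel (\<lambda>\<omega>. 2 * S \<omega>)) 0 G" and Sm: "S \<in> borel_measurable M"
    and q: "q = even_part G \<and> c = 0 \<or> q = odd_part G \<and> c = 1/2"
    and A: "A = {\<omega> \<in> space M. S \<omega> \<in> int_lattice c}"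
    and pos: "measure M A > 0"
  shows "measure M A = poly q 1"
    and "has_pgf (cond_distr M A (\<lambda>\<omega>. S \<omega> - d)) (c - d) (smult (1 / poly q 1) q)"
proof -
  note [measurable] = Sm
  define B where "B = (\<lambda>x. 2 * x) ` int_lattice c"
  have "countable B" by (simp add: B_def int_lattice_def)
  then have B: "B \<in> sets borel" by (rule sets.countable[rotated]) simp
  have A_eq: "A = (\<lambda>\<omega>. 2 * S \<omega>) -` B \<inter> space M" by (auto simp: A B_def)
  have A_meas: "A \<in> events"
    unfolding A_eq by (rule measurable_sets[OF _ B]) measurable
  have real_in_B: "indicator B (real k) = of_bool (if c = 0 then even k else odd k)" for k
  proof -
    have "real k \<in> B \<longleftrightarrow> (if c = 0 then even k else odd k)"
    proof -
      have "real k \<in> B \<longleftrightarrow> (\<exists>j::int. real k = 2 * of_int j + 2 * c)"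
        by (auto simp: B_def int_lattice_def image_image algebra_simps image_iff)
      also have "\<dots> \<longleftrightarrow> (\<exists>j. int k = 2 * j + (if c = 0 then 0 else 1))"
      proof (intro ex_cong1)
        fix j
        have "real k = 2 * of_int j + 2 * c \<longleftrightarrow>
            (of_int (int k) :: real) = of_int (2 * j + (if c = 0 then 0 else 1))"
          using q by auto
        then show "real k = 2 * of_int j + 2 * c \<longleftrightarrow> int k = 2 * j + (if c = 0 then 0 else 1)"
          by (simp only: of_int_eq_iff)
      qed
      also have "\<dots> \<longleftrightarrow> (if c = 0 then even k else odd k)"
        by (auto simp: dvd_def elim!: oddE) presburger+
      finally show ?thesis .
    qed
    then show ?thesis by (simp add: indicator_def)
  qed
  show MA: "measure M A = poly q 1"
  proof -
    have "measure M A = measure (distr M borel (\<lambda>\<omega>. 2 * S \<omega>)) B"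
      unfolding A_eq using B by (simp add: measure_distr)
    also have "\<dots> = (\<integral>x. indicator B x \<partial>distr M borel (\<lambda>\<omega>. 2 * S \<omega>))" by simp
    also have "\<dots> = (\<Sum>k\<le>degree G. coeff G k * indicator B (real k + 0))"
      by (rule has_pgf_integral[OF S borel_measurable_indicator[OF B]])
    also have "\<dots> = (\<Sum>k\<le>degree G. (coeff G k + (if c = 0 then 1 else - 1) * (coeff G k * (-1) ^ k)) / 2)"
      by (intro sum.cong refl) (auto simp: real_in_B)
    also have "\<dots> = (poly G 1 + (if c = 0 then 1 else - 1) * poly G (-1)) / 2"
      by (simp only: sum_divide_distrib[symmetric] sum.distrib sum_distrib_left[symmetric])
         (simp add: poly_altdef)
    also have "\<dots> = poly q 1"
      using q poly_even_odd_split[of G 1] poly_even_odd_split[of G "-1"] by auto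
    finally show ?thesis .
  qed
  have atom: "\<P>(\<omega> in M. S \<omega> = real k + c) = coeff q k" for k
  proof -
    define l where "l = (if c = 0 then 2 * k else 2 * k + 1)"
    have l: "real l = 2 * (real k + c)" "coeff q k = coeff G l" using q by (auto simp: l_def)
    have "\<P>(\<omega> in M. S \<omega> = real k + c) = \<P>(\<omega> in M. 2 * S \<omega> = real l)"
      unfolding l by (rule arg_cong[where f = prob]) auto
    also have "\<dots> = measure (distr M borel (\<lambda>\<omega>. 2 * S \<omega>)) {real l + 0}"
      by (simp add: measure_distr vimage_def Int_def conj_commute)
    also have "\<dots> = coeff G l" using S unfolding has_pgf_def by blast
    finally show ?thesis by (simp add: l(2))
  qed
  interpret U: prob_space "uniform_measure M A"
    using pos by (intro prob_space_uniform_measure) (auto simp: emeasure_eq_measure)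
  show "has_pgf (cond_distr M A (\<lambda>\<omega>. S \<omega> - d)) (c - d) (smult (1 / poly q 1) q)"
    unfolding has_pgf_def
  proof (intro conjI allI)
    show "prob_space (cond_distr M A (\<lambda>\<omega>. S \<omega> - d))"
      unfolding cond_distr_def by (rule U.prob_space_distr) (simp add: measurable_cong_sets[OF sets_uniform_measure refl])
    show "sets (cond_distr M A (\<lambda>\<omega>. S \<omega> - d)) = sets borel" by (simp add: cond_distr_def)
    show "poly (smult (1 / poly q 1) q) 1 = 1" using pos MA by simp
    fix k
    have S_eq: "{\<omega> \<in> space M. S \<omega> = real k + c} \<in> events" by measurable
    have "A \<inter> {\<omega> \<in> space M. S \<omega> = real k + c} = {\<omega> \<in> space M. S \<omega> = real k + c}"
      by (auto simp: A int_lattice_def intro!: image_eqI[where x = "int k"])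
    moreover have "(\<lambda>\<omega>. S \<omega> - d) -` {real k + (c - d)} \<inter> space M = {\<omega> \<in> space M. S \<omega> = real k + c}"
      by auto
    ultimately show "measure (cond_distr M A (\<lambda>\<omega>. S \<omega> - d)) {real k + (c - d)} = coeff (smult (1 / poly q 1) q) k"
      unfolding cond_distr_def using pos A_meas S_eq MA atom[of k]
      by (subst measure_distr) (simp_all add: measurable_cong_sets[OF sets_uniform_measure refl] emeasure_eq_measure)
  qed
qed

lemma half_integer_gap:
  assumes "x \<in> int_lattice 0" "y \<in> int_lattice (1/2)" "\<bar>x - y\<bar> < 3"
  shows "\<bar>x - y\<bar> \<le> 5/2"
proof -
  obtain i j where "x = of_int i" "y = of_int j + 1/2" using assms(1,2) by (auto simp: int_lattice_def)
  then have xy: "x - y = of_int (i - j) - 1/2" by simp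
  have "- 3 < (of_int (i - j) :: real)" "(of_int (i - j) :: real) < 4" using assms(3) unfolding xy by linarith+
  then have "- 3 < i - j" "i - j < 4" by linarith+
  then have "- 2 \<le> (of_int (i - j) :: real)" "(of_int (i - j) :: real) \<le> 3" by linarith+
  then show ?thesis unfolding xy by linarith
qed

theorem theorem1:
  fixes M :: "'a measure" and n :: nat
    and X :: "nat \<Rightarrow> 'a \<Rightarrow> real" and T W L :: "nat \<Rightarrow> real"
    and S :: "'a \<Rightarrow> real" and Even Odd :: "'a set"
    and Deven Dodd :: "real measure" and \<mu> \<mu>even \<mu>odd :: real
  assumes "prob_space M"
    and "n \<ge> 1"
    and "prob_space.indep_vars M (\<lambda>_. borel) X {1..n}"
    and "\<And>i. i \<in> {1..n} \<Longrightarrow> L i = 1 - T i - W i"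
    and "\<And>i. i \<in> {1..n} \<Longrightarrow> T i \<ge> 0 \<and> W i \<ge> 0 \<and> L i \<ge> 0"
    and "\<And>i. i \<in> {1..n} \<Longrightarrow> \<P>(\<omega> in M. X i \<omega> = 1/2) = T i"
    and "\<And>i. i \<in> {1..n} \<Longrightarrow> \<P>(\<omega> in M. X i \<omega> = 1) = W i"
    and "\<And>i. i \<in> {1..n} \<Longrightarrow> \<P>(\<omega> in M. X i \<omega> = 0) = L i"
    and "S = (\<lambda>\<omega>. \<Sum>i=1..n. X i \<omega>)"
    and "Even = {\<omega> \<in> space M. S \<omega> \<in> \<int>}"
    and "Odd = {\<omega> \<in> space M. S \<omega> \<in> int_lattice (1/2)}"
    and "measure M Even > 0"
    and "measure M Odd > 0"
    and "\<mu> = integral\<^sup>L M S"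
    and "\<mu>even = cond_mean M Even S"
    and "\<mu>odd = cond_mean M Odd S"
    and "Deven = cond_distr M Even S"
    and "Dodd = cond_distr M Odd S"
  shows
    "(poisson_binomial Deven \<and>
      poisson_binomial (cond_distr M Odd (\<lambda>\<omega>. S \<omega> - 1/2)) \<and>
      log_concave_distr 0 Deven \<and> log_concave_distr (1/2) Dodd \<and>
      card {x. is_mode Deven x} \<in> {1, 2} \<and> card {x. is_mode Dodd x} \<in> {1, 2}) \<and>
     (\<forall>meven modd. is_mode Deven meven \<and> is_mode Dodd modd \<longrightarrow>
        \<bar>meven - \<mu>even\<bar> < 1 \<and> \<bar>modd - \<mu>odd\<bar> < 1) \<and>
     (\<bar>\<mu>even - \<mu>\<bar> \<le> 1/2 \<and> \<bar>\<mu>odd - \<mu>\<bar> \<le> 1/2 \<and> \<bar>\<mu>even - \<mu>odd\<bar> \<le> 1) \<and>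
     (\<forall>meven modd. is_mode Deven meven \<and> is_mode Dodd modd \<longrightarrow>
        \<bar>meven - \<mu>\<bar> < 3/2 \<and> \<bar>modd - \<mu>\<bar> < 3/2 \<and> \<bar>meven - modd\<bar> \<le> 5/2)"
proof -
  interpret prob_space M by fact
  let ?I = "{1..n}"
  define G where "G = (\<Prod>i\<in>?I. [:L i, T i, W i:])"
  have LTW: "L i \<ge> 0 \<and> T i \<ge> 0 \<and> W i \<ge> 0 \<and> L i + T i + W i = 1" if "i \<in> ?I" for i
    using assms(4,5)[OF that] by simp
  have Sm: "S \<in> borel_measurable M"
    unfolding assms(9) using assms(3) by (intro borel_measurable_sum) (simp add: indep_vars_def)
  have law: "has_pgf (distr M borel (\<lambda>\<omega>. 2 * S \<omega>)) 0 G"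
    unfolding assms(9) G_def
    by (rule has_pgf_twice_sum) (use assms(3,6,7,8) LTW in auto)
  have Even': "Even = {\<omega> \<in> space M. S \<omega> \<in> int_lattice 0}"
    unfolding assms(10) Ints_def int_lattice_def by simp
  note even = has_pgf_conditioned[OF law Sm _ Even' \<open>measure M Even > 0\<close>, of "even_part G"]
  note odd = has_pgf_conditioned[OF law Sm _ assms(11) \<open>measure M Odd > 0\<close>, of "odd_part G"]
  have posE: "poly (even_part G) 1 > 0" and posO: "poly (odd_part G) 1 > 0"
    using even(1) odd(1) assms(12,13) by simp_all

  have parity: "\<bar>\<Prod>i\<in>?I. 1 - 2 * T i\<bar> < 1"
  proof -
    have "poly G (-1) = (\<Prod>i\<in>?I. 1 - 2 * T i)"
      unfolding G_def poly_prod
    proof (rule prod.cong[OF refl])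
      fix i assume "i \<in> ?I"
      then have "L i = 1 - T i - W i" by (rule assms(4))
      then show "poly [:L i, T i, W i:] (-1) = 1 - 2 * T i" by simp
    qed
    moreover have "poly G 1 = 1" using law by (simp add: has_pgf_def)
    ultimately show ?thesis
      using posE posO poly_even_odd_split[of G 1] poly_even_odd_split[of G "-1"] by simp
  qed
  have roots: "\<exists>r\<ge>0. z = - complex_of_real r"
    if "q = even_part G \<or> q = odd_part G" "poly (map_poly complex_of_real q) z = 0" for q z
    using hermite_biehler_even_odd[of ?I L T W q z] LTW parity that unfolding G_def by simp
  obtain ps where ps: "set ps \<subseteq> {0..1}" "even_part G = smult (poly (even_part G) 1) (bernoulli_poly ps)"
    using nonpos_rooted_imp_bernoulli_poly[OF _ posE] roots by blast
  obtain qs where qs: "set qs \<subseteq> {0..1}" "odd_part G = smult (poly (odd_part G) 1) (bernoulli_poly qs)"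
    using nonpos_rooted_imp_bernoulli_poly[OF _ posO] roots by blast
  have ps': "smult (1 / poly (even_part G) 1) (even_part G) = bernoulli_poly ps"
    using posE by (subst (2) ps(2)) simp
  have qs': "smult (1 / poly (odd_part G) 1) (odd_part G) = bernoulli_poly qs"
    using posO by (subst (2) qs(2)) simp
  have De: "has_pgf Deven 0 (bernoulli_poly ps)"
    using even(2)[of 0] unfolding assms(17) ps' by simp
  have Do: "has_pgf Dodd (1/2) (bernoulli_poly qs)"
    using odd(2)[of 0] unfolding assms(18) qs' by simp
  have Do': "has_pgf (cond_distr M Odd (\<lambda>\<omega>. S \<omega> - 1/2)) 0 (bernoulli_poly qs)"
    using odd(2)[of "1/2"] unfolding qs' by simp

  have cond_mean: "cond_mean M A S = (\<integral>x. x \<partial>cond_distr M A S)" for A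
    unfolding cond_mean_def cond_distr_def
    by (subst integral_distr) (simp_all add: measurable_cong_sets[OF sets_uniform_measure refl] Sm)
  have mean_e: "\<mu>even = (\<integral>x. x \<partial>Deven)" and mean_o: "\<mu>odd = (\<integral>x. x \<partial>Dodd)"
    unfolding assms(15-18) cond_mean by simp_all
  have "2 * \<mu> = (\<integral>x. x \<partial>distr M borel (\<lambda>\<omega>. 2 * S \<omega>))"
    unfolding assms(14) using Sm by (subst integral_distr) simp_all
  then have mean: "\<mu> = poly (pderiv G) 1 / 2" using has_pgf_mean[OF law] by simp
  have "\<mu>even = poly (pderiv (even_part G)) 1 / poly (even_part G) 1"
    unfolding mean_e has_pgf_mean[OF De] ps'[symmetric] by (simp add: pderiv_smult)
  moreover have "\<mu>odd = poly (pderiv (odd_part G)) 1 / poly (odd_part G) 1 + 1/2"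
    unfolding mean_o has_pgf_mean[OF Do] qs'[symmetric] by (simp add: pderiv_smult)
  ultimately have means: "\<bar>\<mu>even - \<mu>\<bar> \<le> 1/2" "\<bar>\<mu>odd - \<mu>\<bar> \<le> 1/2"
    using parity_conditional_means[of ?I L T W] LTW posE posO unfolding mean G_def by simp_all

  have modes: "\<bar>me - \<mu>even\<bar> < 1" "\<bar>mo - \<mu>odd\<bar> < 1" "me \<in> int_lattice 0" "mo \<in> int_lattice (1/2)"
    if "is_mode Deven me" "is_mode Dodd mo" for me mo
  proof -
    show "\<bar>me - \<mu>even\<bar> < 1" unfolding mean_e by (rule has_pgf_mode_near_mean[OF De ps(1) that(1)])
    show "\<bar>mo - \<mu>odd\<bar> < 1" unfolding mean_o by (rule has_pgf_mode_near_mean[OF Do qs(1) that(2)])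
    show "me \<in> int_lattice 0" "mo \<in> int_lattice (1/2)"
      using that has_pgf_mode_iff[OF De ps(1)] has_pgf_mode_iff[OF Do qs(1)]
      unfolding int_lattice_def by blast+
  qed
  have near: "\<bar>me - \<mu>\<bar> < 3/2" "\<bar>mo - \<mu>\<bar> < 3/2" "\<bar>me - mo\<bar> \<le> 5/2"
    if "is_mode Deven me" "is_mode Dodd mo" for me mo
  proof -
    show me: "\<bar>me - \<mu>\<bar> < 3/2" and mo: "\<bar>mo - \<mu>\<bar> < 3/2"
      using modes(1,2)[OF that] means by linarith+
    show "\<bar>me - mo\<bar> \<le> 5/2"
      by (rule half_integer_gap[OF modes(3,4)[OF that]]) (use me mo in linarith)
  qed
  have "\<bar>\<mu>even - \<mu>odd\<bar> \<le> 1" using means by linarith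
  then show ?thesis
    using has_pgf_imp_poisson_binomial[OF De ps(1)] has_pgf_imp_poisson_binomial[OF Do' qs(1)]
      has_pgf_bernoulli_log_concave[OF De ps(1)] has_pgf_bernoulli_log_concave[OF Do qs(1)]
      has_pgf_card_modes[OF De ps(1)] has_pgf_card_modes[OF Do qs(1)] modes(1,2) means near
    by blast
qed

end
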